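(* Let $a>0$ and let $q\in L^2(0,a)$ be real-valued and even ($q(x)=q(a-x)$), and place the same potential $q$ on every edge. For the periodic Schrödinger operators $H=-\frac{d^2}{dx^2}+q$ with continuity–Kirchhoff vertex conditions on Archimedean tilings: (a) for the truncated hexagonal tiling $(3,12^2)$, $\sigma_p(H_{trH})=\{\rho^2: S(a,\rho)=0\text{ or }S'(a,\rho)=0\text{ or }S'(a,\rho)=-\frac23\}$; (b) the point spectra of the operators on the snub square tiling $(3^2,4,3,4)$, the rhombi-trihexagonal tiling $(3,4,6,4)$, the snub trihexagonal tiling $(3^4,6)$ and the truncated trihexagonal tiling $(4,6,12)$ coincide and equal $\{\rho^2: S(a,\rho)=0\}$.
   Context: Each tiling is viewed as an infinite metric graph $G$ in the plane whose edges are the sides of its regular polygons, all of length $a$, each edge identified with $[0,a]$. Vertex configurations: truncated hexagonal $(3,12,12)$; snub square $(3,3,4,3,4)$; rhombi-trihexagonal $(3,4,6,4)$; snub trihexagonal $(3,3,3,3,6)$; truncated trihexagonal $(4,6,12)$. The operator $H$ acts by $y_e\mapsto -y_e''+qy_e$ on each edge, with domain the functions $\mathbf y=(y_e)$ with $y_e\in H^2(e)$, $\sum_e\|y_e\|^2_{H^2(e)}<\infty$, continuous at each vertex and with the sum of outgoing derivatives at each vertex equal to zero; it is self-adjoint and periodic with respect to the translation lattice of the tiling. $\sigma_p$ denotes the point spectrum (the set of eigenvalues). $S(x,\rho)$ denotes the solution of $-y''+qy=\rho^2y$ on $[0,a]$ with $S(0,\rho)=0$, $S'(0,\rho)=1$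 (prime is $d/dx$). *)

theory Defs
  imports "HOL-Analysis.Analysis"
begin

text \<open>A metric graph is given by a set of edges E together with maps src, tgt from edges to
vertices.  Each edge e is identified with the interval [0,a], the point 0 corresponding to
src e and the point a to tgt e.  A function on the graph is a family of functions y e on [0,a].\<close>

text \<open>H2_triple a f f1 f2: f belongs to the Sobolev space H^2(0,a), represented by its
continuous representative, with first derivative f1 (absolutely continuous) and second
derivative f2 in L^2(0,a).\<close>
definition H2_triple :: "real \<Rightarrow> (real \<Rightarrow> complex) \<Rightarrow> (real \<Rightarrow> complex) \<Rightarrow> (real \<Rightarrow> complex) \<Rightarrow> bool" where
  "H2_triple a f f1 f2 \<longleftrightarrow>
     set_borel_measurable lebesgue {0..a} f2 \<and>
     set_integrable lebesgue {0..a} (\<lambda>t. (cmod (f2 t))\<^sup>2) \<and>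
     (\<forall>x\<in>{0..a}. f1 x = f1 0 + (LINT t:{0..x}|lebesgue. f2 t) \<and>
                  f x = f 0 + (LINT t:{0..x}|lebesgue. f1 t))"

definition H2_norm2 :: "real \<Rightarrow> (real \<Rightarrow> complex) \<Rightarrow> (real \<Rightarrow> complex) \<Rightarrow> (real \<Rightarrow> complex) \<Rightarrow> real" where
  "H2_norm2 a f f1 f2 =
     (LINT t:{0..a}|lebesgue. (cmod (f t))\<^sup>2 + (cmod (f1 t))\<^sup>2 + (cmod (f2 t))\<^sup>2)"

definition is_eigenfunction ::
  "real \<Rightarrow> (real \<Rightarrow> real) \<Rightarrow> 'e set \<Rightarrow> ('e \<Rightarrow> 'v) \<Rightarrow> ('e \<Rightarrow> 'v) \<Rightarrow> complex \<Rightarrow>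
   ('e \<Rightarrow> real \<Rightarrow> complex) \<Rightarrow> ('e \<Rightarrow> real \<Rightarrow> complex) \<Rightarrow> ('e \<Rightarrow> real \<Rightarrow> complex) \<Rightarrow> bool" where
  "is_eigenfunction a q E src tgt lam y y1 y2 \<longleftrightarrow>
     (\<forall>e\<in>E. H2_triple a (y e) (y1 e) (y2 e)) \<and>
     (\<lambda>e. H2_norm2 a (y e) (y1 e) (y2 e)) summable_on E \<and>
     (\<forall>v. \<exists>c. \<forall>e\<in>E. (src e = v \<longrightarrow> y e 0 = c) \<and> (tgt e = v \<longrightarrow> y e a = c)) \<and>
     (\<forall>v. (\<Sum>e\<in>{e\<in>E. src e = v}. y1 e 0) - (\<Sum>e\<in>{e\<in>E. tgt e = v}. y1 e a) = 0) \<and>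
     (\<forall>e\<in>E. AE t in lebesgue. t \<in> {0..a} \<longrightarrow>
        - y2 e t + complex_of_real (q t) * y e t = lam * y e t) \<and>
     (\<exists>e\<in>E. \<exists>t\<in>{0..a}. y e t \<noteq> 0)"

definition point_spectrum ::
  "real \<Rightarrow> (real \<Rightarrow> real) \<Rightarrow> 'e set \<Rightarrow> ('e \<Rightarrow> 'v) \<Rightarrow> ('e \<Rightarrow> 'v) \<Rightarrow> complex set" where
  "point_spectrum a q E src tgt =
     {lam. \<exists>y y1 y2. is_eigenfunction a q E src tgt lam y y1 y2}"

text \<open>S_pair a q rho = (S(.,rho), S'(.,rho)) on [0,a] (set to 0 outside [0,a]):
the (Caratheodory) solution of -y'' + q y = rho^2 y with y(0)=0, y'(0)=1; the second
component is the x-derivative.\<close>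
definition S_pair :: "real \<Rightarrow> (real \<Rightarrow> real) \<Rightarrow> complex \<Rightarrow> (real \<Rightarrow> complex) \<times> (real \<Rightarrow> complex)" where
  "S_pair a q rho = (THE (s, s1).
      continuous_on {0..a} s \<and> continuous_on {0..a} s1 \<and>
      (\<forall>x\<in>{0..a}. s x = (LINT t:{0..x}|lebesgue. s1 t) \<and>
                   s1 x = 1 + (LINT t:{0..x}|lebesgue. (complex_of_real (q t) - rho\<^sup>2) * s t)) \<and>
      (\<forall>x. x \<notin> {0..a} \<longrightarrow> s x = 0 \<and> s1 x = 0))"

definition S_fun :: "real \<Rightarrow> (real \<Rightarrow> real) \<Rightarrow> real \<Rightarrow> complex \<Rightarrow> complex" where
  "S_fun a q x rho = fst (S_pair a q rho) x"

definition S_der :: "real \<Rightarrow> (real \<Rightarrow> real) \<Rightarrow> real \<Rightarrow> complex \<Rightarrow> complex" where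
  "S_der a q x rho = snd (S_pair a q rho) x"

text \<open>A Z^2-periodic graph is described by a list of edge orbits (i, j, m, n): for every
cell (p,r) in Z^2 there is an edge from vertex (p, r, i) to vertex (p+m, r+n, j).
Vertices are triples (p, r, i) (cell and index of the vertex in the cell); edges are triples
(p, r, k) with k < length es.\<close>
type_synonym per_graph = "(nat \<times> nat \<times> int \<times> int) list"

definition per_E :: "per_graph \<Rightarrow> (int \<times> int \<times> nat) set" where
  "per_E es = {(p, r, k). k < length es}"

definition per_src :: "per_graph \<Rightarrow> int \<times> int \<times> nat \<Rightarrow> int \<times> int \<times> nat" where
  "per_src es e = (case e of (p, r, k) \<Rightarrow> (case es ! k of (i, j, m, n) \<Rightarrow> (p, r, i)))"

definition per_tgt :: "per_graph \<Rightarrow> int \<times> int \<times> nat \<Rightarrow> int \<times> int \<times> nat" where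
  "per_tgt es e = (case e of (p, r, k) \<Rightarrow> (case es ! k of (i, j, m, n) \<Rightarrow> (p + m, r + n, j)))"

abbreviation per_point_spectrum :: "real \<Rightarrow> (real \<Rightarrow> real) \<Rightarrow> per_graph \<Rightarrow> complex set" where
  "per_point_spectrum a q es \<equiv> point_spectrum a q (per_E es) (per_src es) (per_tgt es)"

section \<open>The five Archimedean tilings (edge length 1, coordinates as complex numbers, w = exp(i pi/3))\<close>

text \<open>Truncated hexagonal tiling (3.12.12). Lattice basis b1 = 2+sqrt 3, b2 = (2+sqrt 3) w.
Vertices in cell (0,0): 0: 1.366+1.366i, 1: 1.866+0.5i, 2: 2.366+1.366i,
3: 3.232+1.866i, 4: 3.732+2.732i, 5: 4.232+1.866i.
The edges are exactly the pairs of vertices at distance 1.\<close>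
definition trH_graph :: per_graph where
  "trH_graph = [(0,1,0,0), (0,2,0,0), (1,2,0,0), (2,3,0,0), (3,4,0,0), (3,5,0,0), (4,5,0,0),
                (4,1,0,1), (5,0,1,0)]"

text \<open>Snub square tiling (3.3.4.3.4). Lattice basis b1 = s, b2 = s i with s = sqrt(2+sqrt 3).
Vertices: 0: 0.354+0.612i, 1: 0.612+1.578i, 2: 1.319+0.354i, 3: 1.578+1.319i.\<close>
definition snubSq_graph :: per_graph where
  "snubSq_graph = [(0,1,0,0), (0,2,0,0), (1,3,0,0), (1,0,0,1), (1,2,0,1), (2,3,0,0), (2,0,1,0),
                   (3,2,0,1), (3,0,1,0), (3,1,1,0)]"

text \<open>Rhombi-trihexagonal tiling (3.4.6.4). Lattice basis b1 = 1+sqrt 3, b2 = (1+sqrt 3) w.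
Vertices: 0: 0.866+0.5i, 1: 1.366+1.366i, 2: 1.866+0.5i, 3: 2.232+1.866i, 4: 2.732+i,
5: 3.232+1.866i.\<close>
definition rhombi_graph :: per_graph where
  "rhombi_graph = [(0,1,0,0), (0,2,0,0), (1,2,0,0), (1,3,0,0), (2,4,0,0), (3,4,0,0), (3,5,0,0),
                   (3,0,0,1), (4,5,0,0), (4,0,1,0), (5,2,0,1), (5,1,1,0)]"

text \<open>Snub trihexagonal tiling (3.3.3.3.6): the triangular lattice Z[w] with the index 7
sublattice (2+w)Z[w] removed. Lattice basis b1 = 2+w, b2 = (2+w) w.
Vertices: 0: w, 1: 2w, 2: 1+w, 3: 3w, 4: 1+2w, 5: 1+3w.\<close>
definition snubTH_graph :: per_graph where
  "snubTH_graph = [(0,1,0,0), (0,2,0,0), (1,2,0,0), (1,3,0,0), (1,4,0,0), (2,4,0,0), (3,4,0,0),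
                   (3,5,0,0), (3,0,0,1), (3,2,0,1), (4,5,0,0), (4,0,1,0), (5,2,0,1), (5,0,1,0),
                   (5,1,1,0)]"

text \<open>Truncated trihexagonal tiling (4.6.12). Lattice basis b1 = 3+sqrt 3, b2 = (3+sqrt 3) w.
Vertices: the 12 vertices of the 12-gon centred at 0 (radius 1/(2 sin(pi/12)), angles
15+30k degrees), reduced modulo the lattice and sorted by coordinates.\<close>
definition trTH_graph :: per_graph where
  "trTH_graph = [(0,1,0,0), (0,2,0,0), (1,3,0,0), (2,4,0,0), (3,5,0,0), (4,5,0,0), (4,6,0,0),
                 (5,7,0,0), (6,7,0,0), (6,8,0,0), (7,9,0,0), (8,10,0,0), (8,1,0,1),
                 (9,11,0,0), (9,0,1,0), (10,11,0,0), (10,3,0,1), (11,2,1,0)]"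

end

theory Submission
  imports Defs
begin

text \<open>If \<open>S(a) \<noteq> 0\<close>, a solution on an edge is determined by its end values and, \<open>q\<close> being even, both
  outgoing end derivatives are given by the same formula; hence eigenfunctions correspond to
  square summable vertex functions \<open>f\<close> with \<open>\<Sum> f(w) = deg v S'(a) f(v)\<close>, the sum ranging over the
  neighbours \<open>w\<close> of \<open>v\<close>.  If \<open>S(a) = 0\<close>, multiples of \<open>S\<close> along a closed walk that splits into two
  directed paths of equal length give an eigenfunction of bounded support.

  A square summable \<open>f\<close> is excluded by comparing dimensions (amenability of \<open>\<int>\<^sup>2\<close>): if the discrete
  operator is injective on finitely supported functions, then its range on functions supported in
  a box of side \<open>N\<close> has codimension \<open>O(N)\<close> in a slightly larger box, so among the \<open>N\<^sup>2\<close> point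
  masses some one is at distance \<open>O(N\<^sup>-\<^sup>1\<^sup>/\<^sup>2)\<close> from the range; as \<open>f\<close> is orthogonal to the
  range, \<open>f = 0\<close>.  Finitely supported solutions vanish by peeling off the lowest vertex of the
  support, except for the two flat bands of the truncated hexagonal tiling.\<close>

section \<open>The edge equation\<close>

text \<open>Floquet theory would ask, for each tiling, for a determinant depending on two
  quasimomenta and for its factors free of them. The dimension count replaces this computation: it
  passes from square summable to finitely supported vertex functions, and there a choice of heights
  settles every value of S'(a) at once. That uniformity also explains the exception. The truncated
  hexagonal tiling does have finitely supported solutions for two values of S'(a), so no choice of
  heights can work for its vertices directly. All its vertices have degree 3, so S'(a) = mu/3 for an
  adjacency eigenvalue mu. A vertex function is recovered from its triangle sums after division by
  mu (mu + 2), and the two roots 0 and -2 give S'(a) = 0 and S'(a) = -2/3. Evenness of q makes the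
  two ends of an edge look alike, so that the orientation of edges, needed to write the graph down,
  drops out of the vertex equation.\<close>

definition L2_on :: "real set \<Rightarrow> (real \<Rightarrow> complex) \<Rightarrow> bool" where
  "L2_on S f \<longleftrightarrow> f \<in> borel_measurable (lebesgue_on S) \<and> (\<lambda>t. (norm (f t))\<^sup>2) integrable_on S"

lemma L2_on_subinterval:
  assumes "L2_on {a..b} f" "{c..d} \<subseteq> {a..b}"
  shows "L2_on {c..d} f"
  unfolding L2_on_def
proof
  show "f \<in> borel_measurable (lebesgue_on {c..d})"
    using assms measurable_restrict_mono unfolding L2_on_def by metis
  show "(\<lambda>t. (norm (f t))\<^sup>2) integrable_on {c..d}"
    using assms integrable_on_subinterval unfolding L2_on_def by metis
qed

lemma continuous_imp_L2_on:
  assumes "continuous_on {a..b} f"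
  shows "L2_on {a..b} f"
  unfolding L2_on_def
proof
  show "f \<in> borel_measurable (lebesgue_on {a..b})"
    using assms by (intro continuous_imp_measurable_on_sets_lebesgue) auto
  show "(\<lambda>t. (norm (f t))\<^sup>2) integrable_on {a..b}"
    using assms by (intro integrable_continuous_real continuous_intros)
qed

lemma L2_on_mult_absolutely_integrable:
  assumes "L2_on {a..b} f" "L2_on {a..b} g"
  shows "(\<lambda>t. f t * g t) absolutely_integrable_on {a..b}"
proof (rule measurable_bounded_by_integrable_imp_absolutely_integrable)
  show "(\<lambda>t. f t * g t) \<in> borel_measurable (lebesgue_on {a..b})"
    using assms unfolding L2_on_def by (intro borel_measurable_times) auto
  show "(\<lambda>t. (norm (f t))\<^sup>2 + (norm (g t))\<^sup>2) integrable_on {a..b}"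
    using assms unfolding L2_on_def by (intro integrable_add) auto
  show "norm (f t * g t) \<le> (norm (f t))\<^sup>2 + (norm (g t))\<^sup>2" for t
    using sum_squares_bound[of "norm (f t)" "norm (g t)"]
      mult_nonneg_nonneg[OF norm_ge_zero[of "f t"] norm_ge_zero[of "g t"]]
    unfolding norm_mult by linarith
qed auto

lemma L2_on_imp_absolutely_integrable:
  assumes "L2_on {a..b} f"
  shows "f absolutely_integrable_on {a..b}"
  using L2_on_mult_absolutely_integrable[OF assms continuous_imp_L2_on[OF continuous_on_const[of _ 1]]]
  by simp

text \<open>Discriminant argument: the quadratic \<open>quad\<close> in \<open>l\<close> is the
  integral of the square of |f| - l |g|.\<close>

lemma L2_on_Cauchy_Schwarz:
  assumes f: "L2_on {a..b} f" and g: "L2_on {a..b} g"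
  shows "(norm (integral {a..b} (\<lambda>t. f t * g t)))\<^sup>2
           \<le> integral {a..b} (\<lambda>t. (norm (f t))\<^sup>2) * integral {a..b} (\<lambda>t. (norm (g t))\<^sup>2)"
proof -
  define P where "P = integral {a..b} (\<lambda>t. (norm (f t))\<^sup>2)"
  define R where "R = integral {a..b} (\<lambda>t. (norm (g t))\<^sup>2)"
  define M where "M = integral {a..b} (\<lambda>t. norm (f t * g t))"
  have ai: "(\<lambda>t. f t * g t) absolutely_integrable_on {a..b}"
    using L2_on_mult_absolutely_integrable[OF f g] .
  have i1: "(\<lambda>t. (norm (f t))\<^sup>2) integrable_on {a..b}"
    and i2: "(\<lambda>t. (norm (g t))\<^sup>2) integrable_on {a..b}"
    using f g by (auto simp: L2_on_def)
  have i3: "(\<lambda>t. norm (f t * g t)) integrable_on {a..b}"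
    using set_lebesgue_integral_eq_integral(1)[OF set_integrable_norm[OF ai]] .
  have nM: "norm (integral {a..b} (\<lambda>t. f t * g t)) \<le> M"
    unfolding M_def using set_lebesgue_integral_eq_integral(1)[OF ai] i3
    by (intro integral_norm_bound_integral) auto
  have pos: "P \<ge> 0" "R \<ge> 0" "M \<ge> 0"
    unfolding P_def R_def M_def by (auto intro!: integral_nonneg i1 i2 i3)
  have quad: "P - 2 * l * M + l\<^sup>2 * R \<ge> 0" for l
  proof -
    have "((\<lambda>t. (norm (f t))\<^sup>2 - 2 * l * norm (f t * g t) + l\<^sup>2 * (norm (g t))\<^sup>2)
            has_integral (P - 2 * l * M + l\<^sup>2 * R)) {a..b}"
      unfolding P_def R_def M_def
      by (intro has_integral_add has_integral_diff has_integral_mult_right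
          integrable_integral i1 i2 i3)
    moreover have "(norm (f t))\<^sup>2 - 2 * l * norm (f t * g t) + l\<^sup>2 * (norm (g t))\<^sup>2 \<ge> 0" for t
    proof -
      have "(norm (f t))\<^sup>2 - 2 * l * norm (f t * g t) + l\<^sup>2 * (norm (g t))\<^sup>2
              = (norm (f t) - l * norm (g t))\<^sup>2"
        by (simp add: norm_mult power2_eq_square algebra_simps)
      then show ?thesis by simp
    qed
    ultimately show ?thesis using has_integral_nonneg by blast
  qed
  have "M\<^sup>2 \<le> P * R"
  proof (cases "R = 0")
    case True
    have "M = 0"
    proof (rule ccontr)
      assume "M \<noteq> 0"
      \<comment> \<open>With \<open>R = 0\<close> the quadratic is affine in \<open>l\<close>, and
        this value of \<open>l\<close> would make it equal to -1.\<close>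
      then have "2 * ((P + 1) / (2 * M)) * M = P + 1" by simp
      moreover have "((P + 1) / (2 * M))\<^sup>2 * R = 0" using True by simp
      ultimately show False using quad[of "(P + 1) / (2 * M)"] by linarith
    qed
    then show ?thesis using True by simp
  next
    case False
    then have "R > 0" using pos by simp
    have "2 * (M / R) * M = 2 * (M\<^sup>2 / R)" "(M / R)\<^sup>2 * R = M\<^sup>2 / R"
      using \<open>R > 0\<close> by (simp_all add: power2_eq_square)
    then have "M\<^sup>2 / R \<le> P" using quad[of "M / R"] by linarith
    then show ?thesis using \<open>R > 0\<close> by (simp add: pos_divide_le_eq)
  qed
  moreover have "(norm (integral {a..b} (\<lambda>t. f t * g t)))\<^sup>2 \<le> M\<^sup>2"
    using nM by (intro power_mono) auto
  ultimately show ?thesis unfolding P_def R_def by linarith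
qed

text \<open>Caratheodory form of y'' = Q y as a first-order system. \<open>Q\<close> is only square
  integrable, so \<open>s1\<close> need not be differentiable everywhere; gauge integrals replace
  the derivatives.\<close>

definition ode_sol ::
  "real \<Rightarrow> (real \<Rightarrow> complex) \<Rightarrow> (real \<Rightarrow> complex) \<Rightarrow> (real \<Rightarrow> complex) \<Rightarrow> bool" where
  "ode_sol a Q s s1 \<longleftrightarrow> continuous_on {0..a} s \<and> continuous_on {0..a} s1 \<and>
     (\<forall>x\<in>{0..a}. s x = s 0 + integral {0..x} s1 \<and>
                  s1 x = s1 0 + integral {0..x} (\<lambda>t. Q t * s t))"

lemma ode_solD:
  assumes "ode_sol a Q s s1"
  shows "continuous_on {0..a} s" "continuous_on {0..a} s1"
    and "x \<in> {0..a} \<Longrightarrow> s x = s 0 + integral {0..x} s1"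
    and "x \<in> {0..a} \<Longrightarrow> s1 x = s1 0 + integral {0..x} (\<lambda>t. Q t * s t)"
  using assms unfolding ode_sol_def by blast+

lemma ode_sol_linear:
  assumes Q: "L2_on {0..a} Q" and s: "ode_sol a Q s s1" and z: "ode_sol a Q z z1"
  shows "ode_sol a Q (\<lambda>t. c * s t + d * z t) (\<lambda>t. c * s1 t + d * z1 t)"
proof -
  have cs: "continuous_on {0..a} s" "continuous_on {0..a} s1"
      "continuous_on {0..a} z" "continuous_on {0..a} z1"
    using s z unfolding ode_sol_def by auto
  have eqs: "c * s x + d * z x = c * s 0 + d * z 0 + integral {0..x} (\<lambda>t. c * s1 t + d * z1 t) \<and>
        c * s1 x + d * z1 x = c * s1 0 + d * z1 0
           + integral {0..x} (\<lambda>t. Q t * (c * s t + d * z t))" if x: "x \<in> {0..a}" for x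
  proof -
    have sub: "{0..x} \<subseteq> {0..a}" using x by auto
    have c': "continuous_on {0..x} s" "continuous_on {0..x} s1"
      "continuous_on {0..x} z" "continuous_on {0..x} z1"
      using cs sub continuous_on_subset by blast+
    have i1: "s1 integrable_on {0..x}" "z1 integrable_on {0..x}"
      using c' integrable_continuous_real by blast+
    have i2: "(\<lambda>t. Q t * s t) integrable_on {0..x}" "(\<lambda>t. Q t * z t) integrable_on {0..x}"
      using L2_on_mult_absolutely_integrable L2_on_subinterval[OF Q sub] continuous_imp_L2_on c'
        set_lebesgue_integral_eq_integral(1) by blast+
    have "integral {0..x} (\<lambda>t. c * s1 t + d * z1 t) = c * integral {0..x} s1 + d * integral {0..x} z1"
      using i1 by (intro integral_unique has_integral_add has_integral_mult_right integrable_integral)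
    moreover have "integral {0..x} (\<lambda>t. Q t * (c * s t + d * z t))
        = c * integral {0..x} (\<lambda>t. Q t * s t) + d * integral {0..x} (\<lambda>t. Q t * z t)"
    proof -
      have "(\<lambda>t. Q t * (c * s t + d * z t)) = (\<lambda>t. c * (Q t * s t) + d * (Q t * z t))"
        by (auto simp: algebra_simps)
      then show ?thesis using i2
        by (simp only:) (intro integral_unique has_integral_add has_integral_mult_right integrable_integral)
    qed
    moreover have "s x = s 0 + integral {0..x} s1" "s1 x = s1 0 + integral {0..x} (\<lambda>t. Q t * s t)"
      "z x = z 0 + integral {0..x} z1" "z1 x = z1 0 + integral {0..x} (\<lambda>t. Q t * z t)"
      using s z x unfolding ode_sol_def by blast+
    ultimately show ?thesis by (simp only:) (simp add: algebra_simps)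
  qed
  show ?thesis unfolding ode_sol_def
    by (intro conjI ballI eqs continuous_intros cs)
qed

text \<open>The contraction estimate behind existence and uniqueness: in the norm weighted by
  \<open>exp (\<mu> x)\<close> the Volterra operator has norm at most 1/2, because \<open>Q\<close> is square integrable.\<close>

definition volterra_rate :: "real \<Rightarrow> (real \<Rightarrow> complex) \<Rightarrow> real" where
  "volterra_rate a Q = 2 * a\<^sup>2 * integral {0..a} (\<lambda>t. (norm (Q t))\<^sup>2) + 1"

lemma volterra_continuous:
  assumes Q: "L2_on {0..a} Q" and s: "continuous_on {0..a} s"
  shows "continuous_on {0..a} (\<lambda>x. integral {0..x} (\<lambda>t. Q t * s t))"
    and "continuous_on {0..a} (\<lambda>x. integral {0..x} (\<lambda>u. integral {0..u} (\<lambda>t. Q t * s t)))"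
proof -
  have "(\<lambda>t. Q t * s t) integrable_on {0..a}"
    using L2_on_mult_absolutely_integrable[OF Q continuous_imp_L2_on[OF s]]
      set_lebesgue_integral_eq_integral(1) by blast
  then show *: "continuous_on {0..a} (\<lambda>x. integral {0..x} (\<lambda>t. Q t * s t))"
    by (rule indefinite_integral_continuous_1)
  show "continuous_on {0..a} (\<lambda>x. integral {0..x} (\<lambda>u. integral {0..u} (\<lambda>t. Q t * s t)))"
    by (rule indefinite_integral_continuous_1, rule integrable_continuous_real, rule *)
qed

lemma volterra_contraction:
  assumes Q: "L2_on {0..a} Q" and s: "continuous_on {0..a} s" and m: "0 \<le> m"
    and \<mu>: "\<mu> = volterra_rate a Q"
    and bd: "\<And>t. t \<in> {0..a} \<Longrightarrow> norm (s t) \<le> m * exp (\<mu> * t)"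
    and x: "x \<in> {0..a}"
  shows "norm (integral {0..x} (\<lambda>u. integral {0..u} (\<lambda>t. Q t * s t))) \<le> m / 2 * exp (\<mu> * x)"
proof -
  define K where "K = integral {0..a} (\<lambda>t. (norm (Q t))\<^sup>2)"
  have iQ: "(\<lambda>t. (norm (Q t))\<^sup>2) integrable_on {0..a}" using Q by (simp add: L2_on_def)
  have K0: "K \<ge> 0" unfolding K_def using iQ by (intro integral_nonneg) auto
  have mu: "\<mu> = 2 * a\<^sup>2 * K + 1" "\<mu> > 0"
    using \<mu> K0 unfolding volterra_rate_def K_def[symmetric] by (auto intro: add_nonneg_pos)
  \<comment> \<open>Cauchy-Schwarz leaves the integral of exp (2 \<open>\<mu>\<close> t) over [0,u],
    at most exp (2 \<open>\<mu>\<close> u) / (2 \<open>\<mu>\<close>). The factor 1 / (2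
    \<open>\<mu>\<close>) is what makes a large rate contract.\<close>
  have inner: "norm (integral {0..u} (\<lambda>t. Q t * s t)) \<le> m * sqrt (K / (2 * \<mu>)) * exp (\<mu> * u)"
    if u: "u \<in> {0..a}" for u
  proof -
    have sub: "{0..u} \<subseteq> {0..a}" using u by auto
    have Qu: "L2_on {0..u} Q" using L2_on_subinterval[OF Q sub] .
    have su: "L2_on {0..u} s" using continuous_imp_L2_on[OF s] L2_on_subinterval sub by blast
    have e: "((\<lambda>t. m\<^sup>2 * exp (2 * \<mu> * t)) has_integral
        (m\<^sup>2 * exp (2 * \<mu> * u) / (2 * \<mu>) - m\<^sup>2 * exp (2 * \<mu> * 0) / (2 * \<mu>))) {0..u}"
      using u mu(2) by (intro fundamental_theorem_of_calculus)
        (auto intro!: derivative_eq_intros simp: has_real_derivative_iff_has_vector_derivative[symmetric])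
    have "integral {0..u} (\<lambda>t. (norm (s t))\<^sup>2) \<le> m\<^sup>2 * exp (2 * \<mu> * u) / (2 * \<mu>) - m\<^sup>2 * exp (2 * \<mu> * 0) / (2 * \<mu>)"
    proof (rule has_integral_le[OF _ e])
      show "((\<lambda>t. (norm (s t))\<^sup>2) has_integral integral {0..u} (\<lambda>t. (norm (s t))\<^sup>2)) {0..u}"
        using su by (simp add: L2_on_def has_integral_integral)
      fix t assume t: "t \<in> {0..u}"
      then have "(norm (s t))\<^sup>2 \<le> (m * exp (\<mu> * t))\<^sup>2" using bd[of t] u by (intro power_mono) auto
      also have "\<dots> = m\<^sup>2 * exp (2 * \<mu> * t)"
        by (simp add: power_mult_distrib power2_eq_square flip: exp_add)
      finally show "(norm (s t))\<^sup>2 \<le> m\<^sup>2 * exp (2 * \<mu> * t)" .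
    qed
    also have "\<dots> \<le> m\<^sup>2 * exp (2 * \<mu> * u) / (2 * \<mu>)" using mu(2) by simp
    finally have 1: "integral {0..u} (\<lambda>t. (norm (s t))\<^sup>2) \<le> m\<^sup>2 * exp (2 * \<mu> * u) / (2 * \<mu>)" .
    have 2: "integral {0..u} (\<lambda>t. (norm (Q t))\<^sup>2) \<le> K"
      unfolding K_def using iQ sub Qu by (intro integral_subset_le) (auto simp: L2_on_def)
    have "(norm (integral {0..u} (\<lambda>t. Q t * s t)))\<^sup>2
        \<le> integral {0..u} (\<lambda>t. (norm (Q t))\<^sup>2) * integral {0..u} (\<lambda>t. (norm (s t))\<^sup>2)"
      by (rule L2_on_Cauchy_Schwarz[OF Qu su])
    also have "\<dots> \<le> K * (m\<^sup>2 * exp (2 * \<mu> * u) / (2 * \<mu>))"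
      using 1 2 K0 su by (intro mult_mono) (auto simp: L2_on_def intro!: integral_nonneg)
    also have "\<dots> = (m * sqrt (K / (2 * \<mu>)) * exp (\<mu> * u))\<^sup>2"
      using K0 mu(2) by (simp add: power_mult_distrib field_simps power2_eq_square flip: exp_add)
    finally show ?thesis
      using m K0 mu(2) by (intro power2_le_imp_le[of "norm _"]) auto
  qed
  have "norm (integral {0..x} (\<lambda>u. integral {0..u} (\<lambda>t. Q t * s t)))
      \<le> m * sqrt (K / (2 * \<mu>)) * exp (\<mu> * x) * (x - 0)"
  proof (rule integral_bound)
    show "continuous_on {0..x} (\<lambda>u. integral {0..u} (\<lambda>t. Q t * s t))"
      using volterra_continuous(1)[OF Q s] by (rule continuous_on_subset) (use x in auto)
    fix u assume u: "u \<in> {0..x}"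
    have "norm (integral {0..u} (\<lambda>t. Q t * s t)) \<le> m * sqrt (K / (2 * \<mu>)) * exp (\<mu> * u)"
      using inner u x by auto
    also have "\<dots> \<le> m * sqrt (K / (2 * \<mu>)) * exp (\<mu> * x)"
      using u mu(2) m K0 by (intro mult_left_mono) auto
    finally show "norm (integral {0..u} (\<lambda>t. Q t * s t)) \<le> m * sqrt (K / (2 * \<mu>)) * exp (\<mu> * x)" .
  qed (use x in auto)
  also have "\<dots> \<le> m * sqrt (K / (2 * \<mu>)) * exp (\<mu> * x) * a"
    using x m K0 mu(2) by (intro mult_left_mono) auto
  also have "\<dots> = m * (a * sqrt (K / (2 * \<mu>))) * exp (\<mu> * x)" by simp
  also have "\<dots> \<le> m * (1 / 2) * exp (\<mu> * x)"
  proof -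
    \<comment> \<open>Being at most 1/4 amounts to \<open>\<mu>\<close> >= 2 a^2 K, which dictates
      \<open>volterra_rate\<close>; its summand 1 keeps \<open>\<mu>\<close> positive when K =
      0.\<close>
    have "(a * sqrt (K / (2 * \<mu>)))\<^sup>2 = a\<^sup>2 * K / (2 * \<mu>)"
      using K0 mu(2) by (simp add: power_mult_distrib)
    also have "\<dots> \<le> (1 / 2)\<^sup>2" using mu(2) mu(1) by (simp add: field_simps power2_eq_square)
    finally have "a * sqrt (K / (2 * \<mu>)) \<le> 1 / 2" by (rule power2_le_imp_le) simp
    then show ?thesis using m by (intro mult_right_mono mult_left_mono) auto
  qed
  finally show ?thesis by simp
qed

lemma integral_volterra_linear:
  assumes Q: "L2_on {0..a} Q" and s: "continuous_on {0..a} s" and z: "continuous_on {0..a} z"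
    and x: "x \<in> {0..a}"
  shows "integral {0..x} (\<lambda>u. integral {0..u} (\<lambda>t. Q t * (s t - z t)))
    = integral {0..x} (\<lambda>u. integral {0..u} (\<lambda>t. Q t * s t))
      - integral {0..x} (\<lambda>u. integral {0..u} (\<lambda>t. Q t * z t))"
proof -
  have inner: "integral {0..u} (\<lambda>t. Q t * (s t - z t))
      = integral {0..u} (\<lambda>t. Q t * s t) - integral {0..u} (\<lambda>t. Q t * z t)" if u: "u \<in> {0..x}" for u
  proof -
    have sub: "{0..u} \<subseteq> {0..a}" using u x by auto
    have "(\<lambda>t. Q t * s t) integrable_on {0..u}" "(\<lambda>t. Q t * z t) integrable_on {0..u}"
      using L2_on_mult_absolutely_integrable L2_on_subinterval[OF _ sub] Q continuous_imp_L2_on s z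
        set_lebesgue_integral_eq_integral(1) by blast+
    then show ?thesis by (simp add: right_diff_distrib integral_diff)
  qed
  have "(\<lambda>u. integral {0..u} (\<lambda>t. Q t * s t)) integrable_on {0..x}"
    "(\<lambda>u. integral {0..u} (\<lambda>t. Q t * z t)) integrable_on {0..x}"
    by (rule integrable_continuous_real, rule continuous_on_subset, rule volterra_continuous(1)[OF Q s],
        use x in auto)
       (rule integrable_continuous_real, rule continuous_on_subset, rule volterra_continuous(1)[OF Q z],
        use x in auto)
  then show ?thesis
    by (subst integral_diff[symmetric]) (auto intro!: integral_cong inner)
qed

text \<open>Eliminating \<open>s1\<close> leaves one fixed-point equation for \<open>s\<close>, to
  which the contraction estimate applies.\<close>

lemma ode_sol_volterra:
  assumes Q: "L2_on {0..a} Q" and s: "ode_sol a Q s s1" and x: "x \<in> {0..a}"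
  shows "s x = s 0 + s1 0 * of_real x + integral {0..x} (\<lambda>u. integral {0..u} (\<lambda>t. Q t * s t))"
proof -
  have cs: "continuous_on {0..a} s" using s by (simp add: ode_sol_def)
  have i: "(\<lambda>u. integral {0..u} (\<lambda>t. Q t * s t)) integrable_on {0..x}"
    by (rule integrable_continuous_real, rule continuous_on_subset, rule volterra_continuous(1)[OF Q cs])
       (use x in auto)
  have "integral {0..x} s1 = integral {0..x} (\<lambda>u. s1 0 + integral {0..u} (\<lambda>t. Q t * s t))"
    using x by (intro integral_cong ode_solD(4)[OF s]) auto
  also have "\<dots> = integral {0..x} (\<lambda>u. s1 0) + integral {0..x} (\<lambda>u. integral {0..u} (\<lambda>t. Q t * s t))"
    using i by (intro integral_add) auto
  finally show ?thesis using ode_solD(3)[OF s x] x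
    by (simp add: scaleR_conv_of_real mult.commute)
qed

text \<open>The weighted supremum \<open>m\<close> of \<open>s\<close> is attained by compactness,
  and with zero initial data the contraction estimate at that point gives \<open>m\<close> <=
  \<open>m / 2\<close>.\<close>

lemma ode_sol_unique_zero:
  assumes Q: "L2_on {0..a} Q" and s: "ode_sol a Q s s1" and z: "s 0 = 0" "s1 0 = 0"
    and x: "x \<in> {0..a}"
  shows "s x = 0" "s1 x = 0"
proof -
  have cs: "continuous_on {0..a} s" using s by (simp add: ode_sol_def)
  define \<mu> where "\<mu> = volterra_rate a Q"
  have "continuous_on {0..a} (\<lambda>t. norm (s t) * exp (- \<mu> * t))"
    using cs by (intro continuous_intros)
  then obtain y where y: "y \<in> {0..a}"
      "\<And>t. t \<in> {0..a} \<Longrightarrow> norm (s t) * exp (- \<mu> * t) \<le> norm (s y) * exp (- \<mu> * y)"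
    using continuous_attains_sup[of "{0..a}" "\<lambda>t. norm (s t) * exp (- \<mu> * t)"] x by auto
  define m where "m = norm (s y) * exp (- \<mu> * y)"
  have "m \<ge> 0" by (simp add: m_def)
  have bd: "norm (s t) \<le> m * exp (\<mu> * t)" if "t \<in> {0..a}" for t
    using y(2)[OF that] unfolding m_def[symmetric] by (simp add: exp_minus field_simps)
  have "norm (s y) \<le> m / 2 * exp (\<mu> * y)"
    using volterra_contraction[OF Q cs \<open>m \<ge> 0\<close> \<mu>_def bd y(1)] ode_sol_volterra[OF Q s y(1)] z by simp
  then have "m \<le> m / 2" unfolding m_def by (simp add: exp_minus field_simps)
  then have "m = 0" using \<open>m \<ge> 0\<close> by simp
  then have s0: "s t = 0" if "t \<in> {0..a}" for t using bd[OF that] by simp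
  then show "s x = 0" using x by simp
  have "s1 x = s1 0 + integral {0..x} (\<lambda>t. Q t * s t)" using ode_solD(4)[OF s x] .
  also have "integral {0..x} (\<lambda>t. Q t * s t) = integral {0..x} (\<lambda>t. 0)"
    using s0 x by (intro integral_cong) auto
  finally show "s1 x = 0" using z by simp
qed

lemma ode_sol_unique:
  assumes Q: "L2_on {0..a} Q" and s: "ode_sol a Q s s1" and z: "ode_sol a Q z z1"
    and eq: "s 0 = z 0" "s1 0 = z1 0" and x: "x \<in> {0..a}"
  shows "s x = z x" "s1 x = z1 x"
  using ode_sol_unique_zero[OF Q ode_sol_linear[OF Q s z, of 1 "-1"] _ _ x] eq by auto

text \<open>Banach's theorem for bounded continuous functions in the plain supremum metric. The
  unknown \<open>z\<close> is the solution divided by exp (\<open>\<mu>\<close> t), and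
  \<open>E\<close> restores the factor, so that plain distance of \<open>z\<close> is weighted
  distance of solutions.\<close>

lemma ode_sol_exists:
  fixes \<alpha> \<beta> :: complex
  assumes a: "0 \<le> a" and Q: "L2_on {0..a} Q"
  shows "\<exists>s s1. ode_sol a Q s s1 \<and> s 0 = \<alpha> \<and> s1 0 = \<beta>"
proof -
  define \<mu> where "\<mu> = volterra_rate a Q"
  \<comment> \<open>Elements of \<open>bcontfun\<close> live on the whole line; clamping the
    argument to [0,a] extends a function on the edge continuously and boundedly.\<close>
  define c where "c = (\<lambda>x. max 0 (min a x))"
  have c: "c x \<in> {0..a}" for x using a by (auto simp: c_def)
  have c_id: "c x = x" if "x \<in> {0..a}" for x using that by (auto simp: c_def)
  define E where "E = (\<lambda>(z :: real \<Rightarrow>\<^sub>C complex) t. complex_of_real (exp (\<mu> * t)) * apply_bcontfun z t)"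
  have E: "continuous_on S (E z)" for S z unfolding E_def
    by (intro continuous_intros continuous_on_apply_bcontfun)
  define V where "V = (\<lambda>z x. integral {0..x} (\<lambda>u. integral {0..u} (\<lambda>t. Q t * E z t)))"
  define h where "h = (\<lambda>z x. complex_of_real (exp (- \<mu> * x)) * (\<alpha> + \<beta> * of_real x + V z x))"
  have h: "continuous_on {0..a} (h z)" for z
    unfolding h_def V_def by (intro continuous_intros volterra_continuous(2)[OF Q E])
  have hb: "(\<lambda>x. h z (c x)) \<in> bcontfun" for z
  proof -
    have "bounded (h z ` {0..a})"
      using h by (intro compact_imp_bounded compact_continuous_image) auto
    then have "\<exists>B. \<forall>x\<in>{0..a}. norm (h z x) \<le> B" by (simp add: bounded_iff)
    then obtain B where "\<And>x. x \<in> {0..a} \<Longrightarrow> norm (h z x) \<le> B" by blast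
    then have "norm (h z (c x)) \<le> B" for x using c by blast
    moreover have "continuous_on UNIV (\<lambda>x. h z (c x))"
    proof (rule continuous_on_compose2[OF h])
      show "continuous_on UNIV c" unfolding c_def by (intro continuous_intros)
    qed (use c in blast)
    ultimately show ?thesis by (rule bcontfun_normI[rotated])
  qed
  define T where "T = (\<lambda>z. Bcontfun (\<lambda>x. h z (c x)))"
  have T: "apply_bcontfun (T z) x = h z (c x)" for z x
    unfolding T_def using hb by (simp add: Bcontfun_inverse)
  have "dist (T z) (T w) \<le> 1 / 2 * dist z w" for z w
  proof (rule dist_bound)
    fix x
    have "norm (E z t - E w t) \<le> dist z w * exp (\<mu> * t)" for t
    proof -
      have "norm (E z t - E w t) = exp (\<mu> * t) * dist (apply_bcontfun z t) (apply_bcontfun w t)"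
        unfolding E_def by (simp add: dist_norm norm_mult flip: right_diff_distrib)
      also have "\<dots> \<le> exp (\<mu> * t) * dist z w" by (intro mult_left_mono dist_bounded) auto
      finally show ?thesis by (simp add: mult.commute)
    qed
    then have "norm (integral {0..c x} (\<lambda>u. integral {0..u} (\<lambda>t. Q t * (E z t - E w t))))
        \<le> dist z w / 2 * exp (\<mu> * c x)"
      by (intro volterra_contraction[OF Q _ _ \<mu>_def _ c] continuous_intros E) auto
    then have 1: "norm (V z (c x) - V w (c x)) \<le> dist z w / 2 * exp (\<mu> * c x)"
      unfolding V_def using integral_volterra_linear[OF Q E E c] by simp
    have "dist (apply_bcontfun (T z) x) (apply_bcontfun (T w) x)
        = exp (- \<mu> * c x) * norm (V z (c x) - V w (c x))"
      unfolding T h_def by (simp add: dist_norm norm_mult flip: right_diff_distrib)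
    also have "\<dots> \<le> exp (- \<mu> * c x) * (dist z w / 2 * exp (\<mu> * c x))"
      using 1 by (intro mult_left_mono) auto
    also have "\<dots> = 1 / 2 * dist z w" by (simp add: exp_minus field_simps)
    finally show "dist (apply_bcontfun (T z) x) (apply_bcontfun (T w) x) \<le> 1 / 2 * dist z w" .
  qed
  then have "\<exists>!z. T z = z" by (intro banach_fix_type[of "1 / 2"]) auto
  then obtain z where z: "T z = z" by blast
  define s1 where "s1 = (\<lambda>x. \<beta> + integral {0..x} (\<lambda>t. Q t * E z t))"
  have Ez: "E z x = \<alpha> + \<beta> * of_real x + V z x" if x: "x \<in> {0..a}" for x
  proof -
    have "apply_bcontfun z x = h z x" using T[of z x] c_id[OF x] z by simp
    then show ?thesis unfolding E_def h_def
      by (simp add: mult.assoc[symmetric] flip: of_real_mult exp_add)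
  qed
  have "ode_sol a Q (E z) s1"
    unfolding ode_sol_def
  proof (intro conjI ballI)
    show "continuous_on {0..a} (E z)" by (rule E)
    show "continuous_on {0..a} s1"
      unfolding s1_def by (intro continuous_intros volterra_continuous(1)[OF Q E])
    fix x assume x: "x \<in> {0..a}"
    have i: "(\<lambda>u. integral {0..u} (\<lambda>t. Q t * E z t)) integrable_on {0..x}"
      by (rule integrable_continuous_real, rule continuous_on_subset, rule volterra_continuous(1)[OF Q E])
         (use x in auto)
    have "integral {0..x} s1 = integral {0..x} (\<lambda>u. \<beta>) + V z x"
      unfolding s1_def V_def using i by (intro integral_add) auto
    then show "E z x = E z 0 + integral {0..x} s1"
      using Ez[OF x] Ez[of 0] a x by (simp add: V_def scaleR_conv_of_real mult.commute)
    show "s1 x = s1 0 + integral {0..x} (\<lambda>t. Q t * E z t)" by (simp add: s1_def)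
  qed
  moreover have "E z 0 = \<alpha>" "s1 0 = \<beta>" using Ez[of 0] a by (auto simp: V_def s1_def)
  ultimately show ?thesis by blast
qed

section \<open>Reflection of the edge and boundary values of solutions\<close>

lemma integral_reverse:
  fixes f :: "real \<Rightarrow> complex"
  assumes "f integrable_on {0..a}" "x \<in> {0..a}"
  shows "integral {0..x} (\<lambda>t. f (a - t)) = integral {0..a} f - integral {0..a - x} f"
proof -
  have "f integrable_on {a - x..a}" using assms integrable_on_subinterval[of f "{0..a}"] by auto
  then have "((\<lambda>t. f (- 1 *\<^sub>R t + a)) has_integral
      (1 / \<bar>- 1 :: real\<bar> ^ DIM(real)) *\<^sub>R integral {a - x..a} f)
      ((\<lambda>t. (1 / (- 1)) *\<^sub>R t + - ((1 / (- 1)) *\<^sub>R a)) ` cbox (a - x) a)"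
    by (intro has_integral_affinity) (auto intro: integrable_integral)
  moreover have "(\<lambda>t. (1 / (- 1)) *\<^sub>R t + - ((1 / (- 1)) *\<^sub>R a)) ` cbox (a - x) a = {0..x}"
    by (auto simp: image_iff intro!: bexI[of _ "a - _"])
  ultimately have "integral {0..x} (\<lambda>t. f (a - t)) = integral {a - x..a} f"
    by (simp add: integral_unique)
  also have "\<dots> = integral {0..a} f - integral {0..a - x} f"
    using Henstock_Kurzweil_Integration.integral_combine[of 0 "a - x" a f] assms by (auto simp: algebra_simps)
  finally show ?thesis .
qed

lemma ode_sol_reverse:
  assumes Q: "L2_on {0..a} Q" and a: "0 \<le> a" and s: "ode_sol a Q s s1"
    and even: "AE t in lebesgue_on {0..a}. Q t = Q (a - t)"
  shows "ode_sol a Q (\<lambda>t. s (a - t)) (\<lambda>t. - s1 (a - t))"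
  unfolding ode_sol_def
proof (intro conjI ballI)
  have cs: "continuous_on {0..a} s" "continuous_on {0..a} s1" using s by (auto simp: ode_sol_def)
  show "continuous_on {0..a} (\<lambda>t. s (a - t))" "continuous_on {0..a} (\<lambda>t. - s1 (a - t))"
    by (intro continuous_intros continuous_on_compose2[OF cs(1)] continuous_on_compose2[OF cs(2)]; auto)+
  fix x assume x: "x \<in> {0..a}"
  have eq: "s y = s 0 + integral {0..y} s1" "s1 y = s1 0 + integral {0..y} (\<lambda>t. Q t * s t)"
    if "y \<in> {0..a}" for y using ode_solD(3,4)[OF s that] .
  have i1: "s1 integrable_on {0..a}" using cs by (intro integrable_continuous_real)
  have i2: "(\<lambda>t. Q t * s t) integrable_on {0..a}"
    using L2_on_mult_absolutely_integrable[OF Q continuous_imp_L2_on[OF cs(1)]]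
      set_lebesgue_integral_eq_integral(1) by blast
  have "integral {0..x} (\<lambda>t. - s1 (a - t)) = - (integral {0..a} s1 - integral {0..a - x} s1)"
    using integral_reverse[OF i1 x] by simp
  then show "s (a - x) = s (a - 0) + integral {0..x} (\<lambda>t. - s1 (a - t))"
    using eq(1)[of a] eq(1)[of "a - x"] x a by simp
  \<comment> \<open>Evenness holds only almost everywhere; the exceptional null set does not change
    the integral.\<close>
  obtain N where N: "N \<in> null_sets lebesgue" "{t \<in> {0..a}. Q t \<noteq> Q (a - t)} \<subseteq> N"
    using even by (auto simp: eventually_ae_filter null_sets_restrict_space)
  have "integral {0..x} (\<lambda>t. Q t * s (a - t)) = integral {0..x} (\<lambda>t. Q (a - t) * s (a - t))"
    by (rule integral_spike[of N]) (use N x in \<open>auto simp: negligible_iff_null_sets\<close>)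
  also have "\<dots> = integral {0..a} (\<lambda>t. Q t * s t) - integral {0..a - x} (\<lambda>t. Q t * s t)"
    using integral_reverse[OF i2 x] .
  finally show "- s1 (a - x) = - s1 (a - 0) + integral {0..x} (\<lambda>t. Q t * s (a - t))"
    using eq(2)[of a] eq(2)[of "a - x"] x a by simp
qed

text \<open>Everything rests on C(a) = S'(a) for the solution C with C(0) = 1, C'(0) = 0, a
  consequence of the reflection symmetry. Then y(a) = y(0) S'(a) + y'(0) S(a), and reflecting y
  yields the same formula at the other end.\<close>

lemma ode_sol_boundary:
  assumes Q: "L2_on {0..a} Q" and a: "0 \<le> a"
    and even: "AE t in lebesgue_on {0..a}. Q t = Q (a - t)"
    and S: "ode_sol a Q S S1" "S 0 = 0" "S1 0 = 1"
  shows "\<lbrakk>S a \<noteq> 0; ode_sol a Q y y1\<rbrakk> \<Longrightarrow> S a * y1 0 = y a - S1 a * y 0"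
    and "\<lbrakk>S a \<noteq> 0; ode_sol a Q y y1\<rbrakk> \<Longrightarrow> S a * - y1 a = y 0 - S1 a * y a"
    and "S a \<noteq> 0 \<Longrightarrow> \<exists>y y1. ode_sol a Q y y1 \<and> y 0 = A \<and> y a = B"
proof -
  have ain: "a \<in> {0..a}" using a by simp
  note Srev = ode_sol_reverse[OF Q a S(1) even]
  obtain C C1 where C: "ode_sol a Q C C1" "C 0 = 1" "C1 0 = 0"
    using ode_sol_exists[OF a Q] by blast
  have repr: "y a = y 0 * C a + y1 0 * S a" if "ode_sol a Q y y1" for y y1
    by (rule ode_sol_unique(1)[OF Q that ode_sol_linear[OF Q C(1) S(1)] _ _ ain])
       (use C S in auto)
  \<comment> \<open>compare the representation of \<open>S (a - t)\<close>, which vanishes at \<open>a\<close>\<close>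
  have C_end: "C a = S1 a" if "S a \<noteq> 0"
    using repr[OF Srev] that S by (simp add: algebra_simps)
  have fwd: "S a * y1 0 = y a - S1 a * y 0" if "S a \<noteq> 0" "ode_sol a Q y y1" for y y1
    using repr[OF that(2)] C_end[OF that(1)] by (simp add: algebra_simps)
  show "S a * y1 0 = y a - S1 a * y 0" if "S a \<noteq> 0" "ode_sol a Q y y1" for y y1
    using fwd that .
  show "S a * - y1 a = y 0 - S1 a * y a" if "S a \<noteq> 0" "ode_sol a Q y y1" for y y1
    using fwd[OF that(1) ode_sol_reverse[OF Q a that(2) even]] by simp
  show "\<exists>y y1. ode_sol a Q y y1 \<and> y 0 = A \<and> y a = B" if nz: "S a \<noteq> 0" for A B
  proof -
    obtain y y1 where y: "ode_sol a Q y y1" "y 0 = A" "y1 0 = (B - S1 a * A) / S a"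
      using ode_sol_exists[OF a Q] by blast
    then have "y a = B" using fwd[OF nz y(1)] nz by simp
    then show ?thesis using y by blast
  qed
qed

text \<open>Bridge between the gauge integrals used for solutions and the Lebesgue set integrals in
  \<open>S_pair\<close> and \<open>H2_triple\<close>; all integrands are absolutely integrable,
  where both agree.\<close>

lemma ode_sol_iff_LINT:
  assumes Q: "L2_on {0..a} Q"
  shows "ode_sol a Q s s1 \<longleftrightarrow> continuous_on {0..a} s \<and> continuous_on {0..a} s1 \<and>
     (\<forall>x\<in>{0..a}. s x = s 0 + (LINT t:{0..x}|lebesgue. s1 t) \<and>
                  s1 x = s1 0 + (LINT t:{0..x}|lebesgue. Q t * s t))"
proof -
  have "(LINT t:{0..x}|lebesgue. s1 t) = integral {0..x} s1"
    "(LINT t:{0..x}|lebesgue. Q t * s t) = integral {0..x} (\<lambda>t. Q t * s t)"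
    if c: "continuous_on {0..a} s" "continuous_on {0..a} s1" and x: "x \<in> {0..a}" for x
  proof -
    have sub: "{0..x} \<subseteq> {0..a}" using x by auto
    show "(LINT t:{0..x}|lebesgue. s1 t) = integral {0..x} s1"
      by (intro set_lebesgue_integral_eq_integral(2) L2_on_imp_absolutely_integrable
          L2_on_subinterval[OF continuous_imp_L2_on sub] c)
    show "(LINT t:{0..x}|lebesgue. Q t * s t) = integral {0..x} (\<lambda>t. Q t * s t)"
      by (intro set_lebesgue_integral_eq_integral(2) L2_on_mult_absolutely_integrable
          L2_on_subinterval[OF continuous_imp_L2_on sub] L2_on_subinterval[OF Q sub] c)
  qed
  then show ?thesis unfolding ode_sol_def
    by (intro conj_cong ball_cong refl) simp_all
qed

lemma S_pair_ode_sol: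
  assumes a: "0 \<le> a" and Q: "L2_on {0..a} (\<lambda>t. complex_of_real (q t) - rho\<^sup>2)"
  shows "ode_sol a (\<lambda>t. complex_of_real (q t) - rho\<^sup>2) (\<lambda>x. S_fun a q x rho) (\<lambda>x. S_der a q x rho)"
    and "S_fun a q 0 rho = 0" and "S_der a q 0 rho = 1"
proof -
  let ?Q = "\<lambda>t. complex_of_real (q t) - rho\<^sup>2"
  define P where "P = (\<lambda>(s :: real \<Rightarrow> complex, s1 :: real \<Rightarrow> complex).
      continuous_on {0..a} s \<and> continuous_on {0..a} s1 \<and>
      (\<forall>x\<in>{0..a}. s x = (LINT t:{0..x}|lebesgue. s1 t) \<and>
                   s1 x = 1 + (LINT t:{0..x}|lebesgue. ?Q t * s t)) \<and>
      (\<forall>x. x \<notin> {0..a} \<longrightarrow> s x = 0 \<and> s1 x = 0))"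
  have P: "P (s, s1) \<longleftrightarrow> ode_sol a ?Q s s1 \<and> s 0 = 0 \<and> s1 0 = 1 \<and>
      (\<forall>x. x \<notin> {0..a} \<longrightarrow> s x = 0 \<and> s1 x = 0)" (is "_ \<longleftrightarrow> ?R") for s s1
  proof
    assume L: "P (s, s1)"
    then have "s 0 = (LINT t:{0..0}|lebesgue. s1 t)"
        "s1 0 = 1 + (LINT t:{0..0}|lebesgue. ?Q t * s t)"
      using a unfolding P_def prod.case by (meson atLeastAtMost_iff order_refl)+
    moreover have "(LINT t:{0..0}|lebesgue. g t) = 0" for g :: "real \<Rightarrow> complex"
      using set_lebesgue_integral_eq_integral(2)[OF absolutely_integrable_on_null[of 0 0 g]] by simp
    ultimately have "s 0 = 0" "s1 0 = 1" by simp_all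
    then show ?R
      using L unfolding P_def prod.case ode_sol_iff_LINT[OF Q] by (simp only: add_0) blast
  next
    assume ?R
    then show "P (s, s1)"
      unfolding P_def prod.case ode_sol_iff_LINT[OF Q] by (metis add_0)
  qed
  obtain s s1 where s: "ode_sol a ?Q s s1" "s 0 = 0" "s1 0 = 1"
    using ode_sol_exists[OF a Q] by blast
  \<comment> \<open>Cutting off to 0 outside [0,a] singles out one pair of functions on the whole
    line, so that the definite description in \<open>S_pair\<close> denotes.\<close>
  define r where "r = (\<lambda>(s :: real \<Rightarrow> complex) x. if x \<in> {0..a} then s x else 0)"
  have "ode_sol a ?Q (r s) (r s1)"
    unfolding ode_sol_def
  proof (intro conjI ballI)
    show "continuous_on {0..a} (r s)"
      by (rule continuous_on_eq[OF ode_solD(1)[OF s(1)]]) (simp add: r_def)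
    show "continuous_on {0..a} (r s1)"
      by (rule continuous_on_eq[OF ode_solD(2)[OF s(1)]]) (simp add: r_def)
    fix x assume x: "x \<in> {0..a}"
    have "integral {0..x} (r s1) = integral {0..x} s1"
      "integral {0..x} (\<lambda>t. ?Q t * r s t) = integral {0..x} (\<lambda>t. ?Q t * s t)"
      using x by (auto simp: r_def intro!: integral_cong)
    then show "r s x = r s 0 + integral {0..x} (r s1)"
      "r s1 x = r s1 0 + integral {0..x} (\<lambda>t. ?Q t * r s t)"
      using ode_solD(3,4)[OF s(1) x] x a by (simp_all add: r_def)
  qed
  then have ex: "P (r s, r s1)" unfolding P using s a by (simp add: r_def)
  have "\<exists>!p. P p"
  proof (rule ex1I[of _ "(r s, r s1)"])
    fix p assume "P p"
    then obtain u u1 where p: "p = (u, u1)" and u: "P (u, u1)" by (cases p) auto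
    have "u x = r s x \<and> u1 x = r s1 x" for x
    proof (cases "x \<in> {0..a}")
      case True
      then show ?thesis
        using ode_sol_unique[OF Q _ _ _ _ True, of u u1 "r s" "r s1"] u ex unfolding P by simp
    next
      case False
      then show ?thesis using u ex unfolding P by auto
    qed
    then show "p = (r s, r s1)" using p by auto
  qed (rule ex)
  then have "P (THE p. P p)" by (rule theI')
  moreover have "(THE p. P p) = S_pair a q rho" unfolding P_def S_pair_def by simp
  ultimately have "P (fst (S_pair a q rho), snd (S_pair a q rho))" by simp
  then show "ode_sol a ?Q (\<lambda>x. S_fun a q x rho) (\<lambda>x. S_der a q x rho)"
    "S_fun a q 0 rho = 0" "S_der a q 0 rho = 1"
    unfolding P S_fun_def S_der_def by auto
qed

section \<open>Sobolev functions on one edge\<close>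

lemma H2_triple_L2_on:
  assumes "H2_triple a f f1 f2"
  shows "L2_on {0..a} f2"
proof -
  have "set_borel_measurable lebesgue {0..a} f2"
    and i: "set_integrable lebesgue {0..a} (\<lambda>t. (cmod (f2 t))\<^sup>2)"
    using assms unfolding H2_triple_def by auto
  then have "f2 \<in> borel_measurable (lebesgue_on {0..a})"
    by (simp add: borel_measurable_restrict_space_iff set_borel_measurable_def mult.commute)
  then show ?thesis unfolding L2_on_def using set_lebesgue_integral_eq_integral(1)[OF i] by simp
qed

lemma H2_triple_continuous:
  assumes "H2_triple a f f1 f2"
  shows "continuous_on {0..a} f1" "continuous_on {0..a} f"
proof -
  have i2: "f2 absolutely_integrable_on {0..a}"
    using L2_on_imp_absolutely_integrable[OF H2_triple_L2_on[OF assms]] .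
  have f1: "f1 x = f1 0 + integral {0..x} f2" if "x \<in> {0..a}" for x
  proof -
    have "f2 absolutely_integrable_on {0..x}"
      using absolutely_integrable_on_subinterval[OF i2] that by auto
    from set_lebesgue_integral_eq_integral(2)[OF this] show ?thesis
      using assms that unfolding H2_triple_def by metis
  qed
  have "continuous_on {0..a} (\<lambda>x. f1 0 + integral {0..x} f2)"
    using i2 set_lebesgue_integral_eq_integral(1)
    by (intro continuous_intros indefinite_integral_continuous_1) blast
  then show c1: "continuous_on {0..a} f1"
    by (rule continuous_on_eq) (simp flip: f1)
  have f: "f x = f 0 + integral {0..x} f1" if "x \<in> {0..a}" for x
  proof -
    have "f1 absolutely_integrable_on {0..x}"
      using that by (intro absolutely_integrable_continuous_real continuous_on_subset[OF c1]) auto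
    from set_lebesgue_integral_eq_integral(2)[OF this] show ?thesis
      using assms that unfolding H2_triple_def by metis
  qed
  have "continuous_on {0..a} (\<lambda>x. f 0 + integral {0..x} f1)"
    using c1 by (intro continuous_intros indefinite_integral_continuous_1 integrable_continuous_real)
  then show "continuous_on {0..a} f"
    by (rule continuous_on_eq) (simp flip: f)
qed

lemma H2_triple_ode_sol:
  assumes f: "H2_triple a f f1 f2" and Q: "L2_on {0..a} Q"
    and ae: "AE t in lebesgue. t \<in> {0..a} \<longrightarrow> f2 t = Q t * f t"
  shows "ode_sol a Q f f1"
  unfolding ode_sol_iff_LINT[OF Q]
proof (intro conjI ballI)
  fix x assume x: "x \<in> {0..a}"
  have c: "continuous_on {0..a} f" using H2_triple_continuous[OF f] by blast
  have sub: "{0..x} \<subseteq> {0..a}" using x by auto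
  have 1: "f2 absolutely_integrable_on {0..x}"
    by (rule L2_on_imp_absolutely_integrable[OF L2_on_subinterval[OF H2_triple_L2_on[OF f] sub]])
  have 2: "(\<lambda>t. Q t * f t) absolutely_integrable_on {0..x}"
    by (rule L2_on_mult_absolutely_integrable[OF L2_on_subinterval[OF Q sub]
          L2_on_subinterval[OF continuous_imp_L2_on[OF c] sub]])
  have "(LINT t:{0..x}|lebesgue. f2 t) = (LINT t:{0..x}|lebesgue. Q t * f t)"
    unfolding set_lebesgue_integral_def
  proof (rule integral_cong_AE)
    show "AE t in lebesgue. indicat_real {0..x} t *\<^sub>R f2 t = indicat_real {0..x} t *\<^sub>R (Q t * f t)"
      using ae by eventually_elim (use x in \<open>auto simp: indicator_def\<close>)
  qed (use 1 2 in \<open>simp_all only: set_integrable_def borel_measurable_integrable\<close>)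
  moreover have "f1 x = f1 0 + (LINT t:{0..x}|lebesgue. f2 t)"
    using f x unfolding H2_triple_def by blast
  ultimately show "f1 x = f1 0 + (LINT t:{0..x}|lebesgue. Q t * f t)" by metis
  show "f x = f 0 + (LINT t:{0..x}|lebesgue. f1 t)"
    using f x unfolding H2_triple_def by blast
qed (use H2_triple_continuous[OF f] in auto)

lemma ode_sol_H2_triple:
  assumes Q: "L2_on {0..a} Q" and s: "ode_sol a Q s s1"
  shows "H2_triple a s s1 (\<lambda>t. Q t * s t)"
proof -
  have cs: "continuous_on {0..a} s" using ode_solD[OF s] by blast
  have "\<exists>B. \<forall>t\<in>{0..a}. norm (s t) \<le> B"
    using compact_imp_bounded[OF compact_continuous_image[OF cs]] by (simp add: bounded_iff)
  then obtain B where B: "\<And>t. t \<in> {0..a} \<Longrightarrow> norm (s t) \<le> B" by blast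
  have m: "(\<lambda>t. Q t * s t) \<in> borel_measurable (lebesgue_on {0..a})"
    using Q continuous_imp_L2_on[OF cs] unfolding L2_on_def by (intro borel_measurable_times) auto
  have "(\<lambda>t. (cmod (Q t * s t))\<^sup>2) absolutely_integrable_on {0..a}"
  proof (rule measurable_bounded_by_integrable_imp_absolutely_integrable)
    show "(\<lambda>t. (cmod (Q t * s t))\<^sup>2) \<in> borel_measurable (lebesgue_on {0..a})"
      using m by measurable
    show "(\<lambda>t. B\<^sup>2 * (cmod (Q t))\<^sup>2) integrable_on {0..a}"
      using Q unfolding L2_on_def by (intro integrable_on_mult_right) auto
    show "norm ((cmod (Q t * s t))\<^sup>2) \<le> B\<^sup>2 * (cmod (Q t))\<^sup>2" if "t \<in> {0..a}" for t
    proof -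
      have "(cmod (s t))\<^sup>2 \<le> B\<^sup>2" using B[OF that] by (intro power_mono) auto
      then have "(cmod (Q t))\<^sup>2 * (cmod (s t))\<^sup>2 \<le> (cmod (Q t))\<^sup>2 * B\<^sup>2"
        by (intro mult_left_mono) auto
      then show ?thesis by (simp add: norm_mult power_mult_distrib mult.commute)
    qed
  qed auto
  moreover have "set_borel_measurable lebesgue {0..a} (\<lambda>t. Q t * s t)"
    using m by (simp add: borel_measurable_restrict_space_iff set_borel_measurable_def)
  ultimately show ?thesis
    using s unfolding H2_triple_def ode_sol_iff_LINT[OF Q] by blast
qed

text \<open>Trace estimate, used to turn summable edge norms into square summable vertex values.
  Write f(0) as f(x) minus the integral of f' over [0,x], apply Cauchy-Schwarz to the integral
  (\<open>pt\<close>), and integrate over x in [0,a].\<close>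

lemma H2_norm2_bounds:
  assumes f: "H2_triple a f f1 f2" and a: "0 \<le> a"
  shows "0 \<le> H2_norm2 a f f1 f2"
    and "a * (norm (f 0))\<^sup>2 \<le> (2 + 2 * a\<^sup>2) * H2_norm2 a f f1 f2"
proof -
  note c = H2_triple_continuous[OF f]
  have L: "L2_on {0..a} f" "L2_on {0..a} f1" "L2_on {0..a} f2"
    using c continuous_imp_L2_on H2_triple_L2_on[OF f] by auto
  define I where "I = (\<lambda>g :: real \<Rightarrow> complex. integral {0..a} (\<lambda>t. (norm (g t))\<^sup>2))"
  have i: "(\<lambda>t. (norm (g t))\<^sup>2) integrable_on {0..a}" if "L2_on {0..a} g" for g
    using that by (simp add: L2_on_def)
  have I0: "0 \<le> I g" if "L2_on {0..a} g" for g
    unfolding I_def using i[OF that] by (intro integral_nonneg) auto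
  have ai: "(\<lambda>t. (norm (g t))\<^sup>2) absolutely_integrable_on {0..a}" if "L2_on {0..a} g" for g
    using i[OF that] by (intro nonnegative_absolutely_integrable_1) auto
  have "H2_norm2 a f f1 f2
      = integral {0..a} (\<lambda>t. (norm (f t))\<^sup>2 + (norm (f1 t))\<^sup>2 + (norm (f2 t))\<^sup>2)"
    unfolding H2_norm2_def
    by (intro set_lebesgue_integral_eq_integral(2) set_integral_add(1) ai L)
  also have "\<dots> = I f + I f1 + I f2"
    unfolding I_def using L i by (simp add: integral_add integrable_add)
  finally have H: "H2_norm2 a f f1 f2 = I f + I f1 + I f2" .
  then show "0 \<le> H2_norm2 a f f1 f2" using I0 L by simp
  have pt: "(norm (f 0))\<^sup>2 \<le> 2 * (norm (f x))\<^sup>2 + 2 * a * I f1" if x: "x \<in> {0..a}" for x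
  proof -
    have sub: "{0..x} \<subseteq> {0..a}" using x by auto
    have L1: "L2_on {0..x} f1" by (rule L2_on_subinterval[OF L(2) sub])
    have "(norm (integral {0..x} (\<lambda>t. f1 t * 1)))\<^sup>2
        \<le> integral {0..x} (\<lambda>t. (norm (f1 t))\<^sup>2) * integral {0..x} (\<lambda>t. (norm (1::complex))\<^sup>2)"
      by (intro L2_on_Cauchy_Schwarz L1 continuous_imp_L2_on continuous_intros)
    also have "\<dots> = integral {0..x} (\<lambda>t. (norm (f1 t))\<^sup>2) * x" using x by simp
    also have "\<dots> \<le> I f1 * a"
      unfolding I_def using x L1 i[OF L(2)] sub I0[OF L(2)]
      by (intro mult_mono integral_subset_le) (auto simp: L2_on_def I_def)
    finally have b: "(norm (integral {0..x} f1))\<^sup>2 \<le> I f1 * a" by simp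
    have "f1 absolutely_integrable_on {0..x}" by (rule L2_on_imp_absolutely_integrable[OF L1])
    from set_lebesgue_integral_eq_integral(2)[OF this] have "f x = f 0 + integral {0..x} f1"
      using f x unfolding H2_triple_def by metis
    then have "f 0 = f x - integral {0..x} f1" by (metis add_diff_cancel_right')
    then have "norm (f 0) \<le> norm (f x) + norm (integral {0..x} f1)"
      by (metis norm_triangle_ineq4)
    then have "(norm (f 0))\<^sup>2 \<le> (norm (f x) + norm (integral {0..x} f1))\<^sup>2"
      by (intro power_mono) auto
    also have "\<dots> \<le> 2 * (norm (f x))\<^sup>2 + 2 * (norm (integral {0..x} f1))\<^sup>2"
      using sum_squares_bound[of "norm (f x)" "norm (integral {0..x} f1)"]
      by (simp add: power2_sum)
    also have "\<dots> \<le> 2 * (norm (f x))\<^sup>2 + 2 * (I f1 * a)" using b by linarith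
    finally show ?thesis by (simp add: ac_simps)
  qed
  have "((\<lambda>x. (norm (f 0))\<^sup>2) has_integral a *\<^sub>R (norm (f 0))\<^sup>2) {0..a}"
    using has_integral_const_real[of "(norm (f 0))\<^sup>2" 0 a] a by simp
  moreover have "((\<lambda>x. 2 * (norm (f x))\<^sup>2 + 2 * a * I f1) has_integral
      (2 * I f + a *\<^sub>R (2 * a * I f1))) {0..a}"
    unfolding I_def
    using has_integral_const_real[of "2 * a * integral {0..a} (\<lambda>t. (norm (f1 t))\<^sup>2)" 0 a] a i[OF L(1)]
    by (intro has_integral_add has_integral_mult_right integrable_integral) auto
  ultimately have "a *\<^sub>R (norm (f 0))\<^sup>2 \<le> 2 * I f + a *\<^sub>R (2 * a * I f1)"
    by (rule has_integral_le) (rule pt)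
  then have "a * (norm (f 0))\<^sup>2 \<le> 2 * I f + a * (2 * a * I f1)" by simp
  also have "\<dots> \<le> (2 + 2 * a\<^sup>2) * (I f + I f1 + I f2)"
  proof -
    have "(2 + 2 * a\<^sup>2) * (I f + I f1 + I f2)
        = 2 * I f + a * (2 * a * I f1) + (2 * I f1 + 2 * I f2 + 2 * a\<^sup>2 * (I f + I f2))"
      by algebra
    moreover have "0 \<le> 2 * I f1 + 2 * I f2 + 2 * a\<^sup>2 * (I f + I f2)"
      using I0 L by (intro add_nonneg_nonneg mult_nonneg_nonneg) auto
    ultimately show ?thesis by linarith
  qed
  finally show "a * (norm (f 0))\<^sup>2 \<le> (2 + 2 * a\<^sup>2) * H2_norm2 a f f1 f2" unfolding H .
qed

section \<open>Square summable kernels on periodic graphs\<close>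

text \<open>A trace estimate: the orthogonal projection of \<open>\<complex>\<^sup>B\<close> onto the complement of the range of \<open>L\<close>
  has trace \<open>card B - card J\<close>, so some point mass is almost in that range.\<close>

locale linear_operator =
  fixes L :: "('v \<Rightarrow> complex) \<Rightarrow> 'v \<Rightarrow> complex"
  assumes lin: "L (\<lambda>v. f v + c * g v) = (\<lambda>v. L f v + c * L g v)"
begin

lemma zero: "L (\<lambda>v. 0) = (\<lambda>v. 0)"
  using lin[of "\<lambda>v. 0" "-1" "\<lambda>v. 0"] by simp

lemma sum: "finite A \<Longrightarrow> L (\<lambda>v. \<Sum>j\<in>A. c j * g j v) = (\<lambda>v. \<Sum>j\<in>A. c j * L (g j) v)"
proof (induction A rule: finite_induct)
  case empty
  then show ?case by (simp add: zero)
next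
  case (insert x A)
  have "L (\<lambda>v. \<Sum>j\<in>insert x A. c j * g j v) = L (\<lambda>v. (\<Sum>j\<in>A. c j * g j v) + c x * g x v)"
    using insert by (simp add: add.commute)
  also have "\<dots> = (\<lambda>v. \<Sum>j\<in>insert x A. c j * L (g j) v)"
    unfolding lin using insert by (simp add: add.commute)
  finally show ?case .
qed

text \<open>Gram-Schmidt in the range of \<open>L\<close>, carried out on preimages: the
  \<open>g i\<close> stay supported in \<open>J\<close> while their images become orthonormal. Each
  new index contributes its point mass \<open>d\<close>, corrected by the earlier preimages.\<close>

lemma orthonormal_range:
  assumes B: "finite B" and J: "finite J"
    and supp: "\<And>f v. \<lbrakk>\<forall>j. j \<notin> J \<longrightarrow> f j = 0; v \<notin> B\<rbrakk> \<Longrightarrow> L f v = 0"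
    and inj: "\<And>f. \<lbrakk>\<forall>j. j \<notin> J \<longrightarrow> f j = 0; L f = (\<lambda>v. 0)\<rbrakk> \<Longrightarrow> f = (\<lambda>v. 0)"
  shows "\<exists>g :: 'v \<Rightarrow> 'v \<Rightarrow> complex. (\<forall>i\<in>J. \<forall>v. v \<notin> J \<longrightarrow> g i v = 0) \<and>
      (\<forall>i\<in>J. \<forall>j\<in>J. (\<Sum>b\<in>B. L (g i) b * cnj (L (g j) b)) = (if i = j then 1 else 0))"
  using J supp inj
proof (induction J rule: finite_induct)
  case empty
  then show ?case by simp
next
  case (insert x J)
  have "\<exists>g :: 'v \<Rightarrow> 'v \<Rightarrow> complex. (\<forall>i\<in>J. \<forall>v. v \<notin> J \<longrightarrow> g i v = 0) \<and>
      (\<forall>i\<in>J. \<forall>j\<in>J. (\<Sum>b\<in>B. L (g i) b * cnj (L (g j) b)) = (if i = j then 1 else 0))"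
    by (rule insert.IH) (use insert.prems in blast)+
  then obtain g where g: "\<And>i v. \<lbrakk>i \<in> J; v \<notin> J\<rbrakk> \<Longrightarrow> g i v = (0::complex)"
    "\<And>i j. \<lbrakk>i \<in> J; j \<in> J\<rbrakk> \<Longrightarrow> (\<Sum>b\<in>B. L (g i) b * cnj (L (g j) b)) = (if i = j then 1 else 0)"
    by blast
  define d where "d = (\<lambda>v. if v = x then 1 else 0 :: complex)"
  define c where "c = (\<lambda>j. \<Sum>b\<in>B. L d b * cnj (L (g j) b))"
  define h where "h = (\<lambda>v. d v + (- 1) * (\<Sum>j\<in>J. c j * g j v))"
  have Lh: "L h = (\<lambda>v. L d v - (\<Sum>j\<in>J. c j * L (g j) v))"
    unfolding h_def lin sum[OF insert.hyps(1)] by simp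
  have orth: "(\<Sum>b\<in>B. L h b * cnj (L (g i) b)) = 0" if i: "i \<in> J" for i
  proof -
    have "(\<Sum>b\<in>B. L h b * cnj (L (g i) b))
        = c i - (\<Sum>b\<in>B. \<Sum>j\<in>J. c j * (L (g j) b * cnj (L (g i) b)))"
      unfolding Lh c_def by (simp add: left_diff_distrib sum_subtractf sum_distrib_right mult.assoc)
    also have "(\<Sum>b\<in>B. \<Sum>j\<in>J. c j * (L (g j) b * cnj (L (g i) b)))
        = (\<Sum>j\<in>J. c j * (\<Sum>b\<in>B. L (g j) b * cnj (L (g i) b)))"
      by (subst sum.swap) (simp add: sum_distrib_left)
    also have "\<dots> = (\<Sum>j\<in>J. if j = i then c j else 0)"
      using g(2) i by (intro sum.cong) auto
    also have "\<dots> = c i" using i insert.hyps(1) by simp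
    finally show ?thesis by simp
  qed
  have hx: "h x = 1" unfolding h_def d_def using g(1) insert.hyps(2) by simp
  have hsupp: "\<forall>v. v \<notin> insert x J \<longrightarrow> h v = 0" unfolding h_def d_def using g(1) by simp
  define N where "N = (\<Sum>b\<in>B. (norm (L h b))\<^sup>2)"
  \<comment> \<open>\<open>h\<close> has value 1 at \<open>x\<close>, so injectivity forbids
    \<open>L h = 0\<close>; vanishing on \<open>B\<close> would already mean vanishing
    everywhere.\<close>
  have "N \<noteq> 0"
  proof
    assume "N = 0"
    then have "L h b = 0" if "b \<in> B" for b
      using that B unfolding N_def by (subst (asm) sum_nonneg_eq_0_iff) auto
    moreover have "L h b = 0" if "b \<notin> B" for b using insert.prems(1)[OF hsupp that] .
    ultimately have "h = (\<lambda>v. 0)" using insert.prems(2)[OF hsupp] by blast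
    then show False using hx by simp
  qed
  moreover have "N \<ge> 0" unfolding N_def by (simp add: sum_nonneg)
  ultimately have "N > 0" by simp
  define r where "r = complex_of_real (1 / sqrt N)"
  define e where "e = (\<lambda>v. r * h v)"
  have Le: "L e = (\<lambda>v. r * L h v)"
    using lin[of "\<lambda>v. 0" r h] unfolding e_def zero by simp
  have ee: "(\<Sum>b\<in>B. L e b * cnj (L e b)) = 1"
  proof -
    have "(\<Sum>b\<in>B. L e b * cnj (L e b)) = (\<Sum>b\<in>B. r * cnj r * (L h b * cnj (L h b)))"
      unfolding Le by (simp add: ac_simps)
    also have "\<dots> = r * cnj r * of_real N"
      unfolding N_def by (simp add: sum_distrib_left complex_norm_square flip: of_real_power)
    also have "r * cnj r = of_real (1 / N)"
      unfolding r_def using \<open>N > 0\<close> by (simp flip: of_real_mult of_real_divide)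
    finally show ?thesis using \<open>N > 0\<close> by simp
  qed
  have eg: "(\<Sum>b\<in>B. L e b * cnj (L (g i) b)) = 0" if "i \<in> J" for i
    using orth[OF that] unfolding Le by (simp add: mult.assoc flip: sum_distrib_left)
  have ge: "(\<Sum>b\<in>B. L (g i) b * cnj (L e b)) = 0" if "i \<in> J" for i
  proof -
    have "(\<Sum>b\<in>B. L (g i) b * cnj (L e b)) = cnj (\<Sum>b\<in>B. L e b * cnj (L (g i) b))"
      by (simp add: mult.commute)
    then show ?thesis using eg[OF that] by simp
  qed
  have esupp: "e v = 0" if "v \<notin> insert x J" for v using hsupp that unfolding e_def by simp
  show ?case
  proof (intro exI[of _ "g(x := e)"] conjI ballI allI impI)
    fix i v assume "i \<in> insert x J" "v \<notin> insert x J"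
    then show "(g(x := e)) i v = 0" using g(1) esupp by auto
  next
    fix i j assume "i \<in> insert x J" "j \<in> insert x J"
    then show "(\<Sum>b\<in>B. L ((g(x := e)) i) b * cnj (L ((g(x := e)) j) b)) = (if i = j then 1 else 0)"
      using ee eg ge g(2) insert.hyps(2) by auto
  qed
qed

text \<open>\<open>L (f b)\<close> is the orthogonal projection of the point mass at
  \<open>b\<close>, and \<open>D b\<close>, the squared distance, is 1 minus a diagonal entry of the
  projection. The trace gives the sum of \<open>D\<close> over \<open>B\<close>; the minimum over
  \<open>A\<close> is at most the average over \<open>A\<close>.\<close>

lemma point_mass_near_range:
  assumes B: "finite B" and J: "finite J"
    and supp: "\<And>f v. \<lbrakk>\<forall>j. j \<notin> J \<longrightarrow> f j = 0; v \<notin> B\<rbrakk> \<Longrightarrow> L f v = 0"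
    and inj: "\<And>f. \<lbrakk>\<forall>j. j \<notin> J \<longrightarrow> f j = 0; L f = (\<lambda>v. 0)\<rbrakk> \<Longrightarrow> f = (\<lambda>v. 0)"
    and A: "A \<subseteq> B" "A \<noteq> {}"
  shows "\<exists>b\<in>A. \<exists>f. (\<forall>j. j \<notin> J \<longrightarrow> f j = 0) \<and>
     real (card A) * (\<Sum>v\<in>B. (norm ((if v = b then 1 else 0) - L f v))\<^sup>2)
       \<le> real (card B) - real (card J)"
proof -
  obtain g :: "'v \<Rightarrow> 'v \<Rightarrow> complex" where g: "\<And>i v. \<lbrakk>i \<in> J; v \<notin> J\<rbrakk> \<Longrightarrow> g i v = 0"
    "\<And>i j. \<lbrakk>i \<in> J; j \<in> J\<rbrakk> \<Longrightarrow> (\<Sum>b\<in>B. L (g i) b * cnj (L (g j) b)) = (if i = j then 1 else 0)"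
    using orthonormal_range[OF B J supp inj] by blast
  define f where "f = (\<lambda>b v. \<Sum>j\<in>J. cnj (L (g j) b) * g j v)"
  define D where "D = (\<lambda>b. \<Sum>v\<in>B. (norm ((if v = b then 1 else 0) - L (f b) v))\<^sup>2)"
  have Lf: "L (f b) v = (\<Sum>j\<in>J. cnj (L (g j) b) * L (g j) v)" for b v
    unfolding f_def sum[OF J] by simp
  have D: "complex_of_real (D b) = 1 - (\<Sum>j\<in>J. L (g j) b * cnj (L (g j) b))" if b: "b \<in> B" for b
  proof -
    define p where "p = (\<Sum>j\<in>J. L (g j) b * cnj (L (g j) b))"
    have "complex_of_real (D b)
        = (\<Sum>v\<in>B. ((if v = b then 1 else 0) - L (f b) v) * cnj ((if v = b then 1 else 0) - L (f b) v))"
      unfolding D_def by (simp add: complex_norm_square flip: of_real_power)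
    also have "\<dots> = (\<Sum>v\<in>B. (if v = b then 1 - L (f b) b - cnj (L (f b) b) else 0)
          + L (f b) v * cnj (L (f b) v))"
      by (intro sum.cong) (auto simp: algebra_simps)
    also have "\<dots> = 1 - L (f b) b - cnj (L (f b) b) + (\<Sum>v\<in>B. L (f b) v * cnj (L (f b) v))"
      using b B by (simp add: sum.distrib)
    also have "L (f b) b = p" unfolding Lf p_def by (simp add: mult.commute)
    also have "cnj p = p" unfolding p_def by (simp add: mult.commute)
    also have "(\<Sum>v\<in>B. L (f b) v * cnj (L (f b) v)) = p"
    proof -
      have "(\<Sum>v\<in>B. L (f b) v * cnj (L (f b) v))
          = (\<Sum>v\<in>B. \<Sum>i\<in>J. \<Sum>j\<in>J. cnj (L (g i) b) * L (g j) b * (L (g i) v * cnj (L (g j) v)))"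
        unfolding Lf by (simp add: sum_product ac_simps)
      also have "\<dots> = (\<Sum>i\<in>J. \<Sum>j\<in>J. cnj (L (g i) b) * L (g j) b * (\<Sum>v\<in>B. L (g i) v * cnj (L (g j) v)))"
        unfolding sum_distrib_left
        by (rule trans[OF sum.swap], rule sum.cong[OF refl], rule sum.swap)
      also have "\<dots> = (\<Sum>i\<in>J. \<Sum>j\<in>J. if i = j then cnj (L (g i) b) * L (g j) b else 0)"
        using g(2) by (intro sum.cong refl) auto
      also have "\<dots> = p" unfolding p_def using J by (simp add: mult.commute)
      finally show ?thesis .
    qed
    finally show ?thesis unfolding p_def by simp
  qed
  have "complex_of_real (\<Sum>b\<in>B. D b) = of_nat (card B) - (\<Sum>b\<in>B. \<Sum>j\<in>J. L (g j) b * cnj (L (g j) b))"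
    using D by (simp add: sum_subtractf)
  also have "(\<Sum>b\<in>B. \<Sum>j\<in>J. L (g j) b * cnj (L (g j) b)) = of_nat (card J)"
    using g(2) by (subst sum.swap) simp
  finally have "complex_of_real (\<Sum>b\<in>B. D b) = complex_of_real (real (card B) - real (card J))" by simp
  then have total: "(\<Sum>b\<in>B. D b) = real (card B) - real (card J)" by (simp only: of_real_eq_iff)
  have D0: "D b \<ge> 0" for b unfolding D_def by (simp add: sum_nonneg)
  have fA: "finite A" using A(1) B finite_subset by blast
  obtain b where b: "b \<in> A" "\<And>b'. b' \<in> A \<Longrightarrow> D b \<le> D b'"
    using arg_min_if_finite(1)[OF fA A(2), of D] arg_min_least[OF fA A(2), of _ D] by blast
  have "real (card A) * D b \<le> (\<Sum>b\<in>A. D b)" using b(2) sum_bounded_below[of A "D b" D] by simp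
  also have "\<dots> \<le> (\<Sum>b\<in>B. D b)" using A(1) B D0 by (intro sum_mono2) auto
  finally have "real (card A) * D b \<le> real (card B) - real (card J)" using total by simp
  moreover have "\<forall>j. j \<notin> J \<longrightarrow> f b j = 0" unfolding f_def using g(1) by simp
  ultimately show ?thesis using b(1) unfolding D_def by blast
qed

end

section \<open>The vertex operator of a periodic graph\<close>

definition lap_term :: "complex \<Rightarrow> (int \<times> int \<times> nat \<Rightarrow> complex) \<Rightarrow> int \<times> int \<times> nat \<Rightarrow>
    nat \<times> nat \<times> int \<times> int \<Rightarrow> complex" where
  "lap_term s f v e = (case v of (p, r, l) \<Rightarrow> case e of (i, j, m, n) \<Rightarrow>
     (if i = l then f (p + m, r + n, j) - s * f v else 0) +
     (if j = l then f (p - m, r - n, i) - s * f v else 0))"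

text \<open>Adjacency operator minus \<open>s\<close> times the degree: every edge end at
  \<open>v\<close> contributes one neighbour and one copy of \<open>s * f v\<close>.\<close>

definition lap :: "per_graph \<Rightarrow> complex \<Rightarrow> (int \<times> int \<times> nat \<Rightarrow> complex) \<Rightarrow> int \<times> int \<times> nat \<Rightarrow> complex" where
  "lap es s f v = (\<Sum>e\<leftarrow>es. lap_term s f v e)"

lemma lap_Cons: "lap (e # es) s f v = lap_term s f v e + lap es s f v"
  by (simp add: lap_def)

lemma lap_Nil: "lap [] s f v = 0"
  by (simp add: lap_def)

interpretation lap: linear_operator "lap es s"
proof
  fix f g :: "int \<times> int \<times> nat \<Rightarrow> complex" and c
  have "lap es s (\<lambda>v. f v + c * g v) v = lap es s f v + c * lap es s g v" for v
  proof (induction es)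
    case (Cons e es)
    have "lap_term s (\<lambda>v. f v + c * g v) v e = lap_term s f v e + c * lap_term s g v e"
      unfolding lap_term_def by (auto simp: algebra_simps split: prod.splits)
    then show ?case using Cons by (simp add: lap_Cons algebra_simps)
  qed (simp add: lap_Nil)
  then show "lap es s (\<lambda>v. f v + c * g v) = (\<lambda>v. lap es s f v + c * lap es s g v)" by blast
qed

lemma lap_shift:
  "lap es s (\<lambda>(p, r, i). u (p + P, r + R, i)) (p, r, i) = lap es s u (p + P, r + R, i)"
proof (induction es)
  case (Cons e es)
  have "lap_term s (\<lambda>(p, r, i). u (p + P, r + R, i)) (p, r, i) e = lap_term s u (p + P, r + R, i) e"
    unfolding lap_term_def by (auto simp: algebra_simps split: prod.splits)
  then show ?case using Cons by (simp add: lap_Cons)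
qed (simp add: lap_Nil)

text \<open>Offsets of at most one cell ensure that the neighbours of a box lie in the box enlarged
  by one layer.\<close>

definition near :: "nat \<Rightarrow> per_graph \<Rightarrow> bool" where
  "near n es \<longleftrightarrow> (\<forall>(i, j, m, k)\<in>set es. i < n \<and> j < n \<and> \<bar>m\<bar> \<le> 1 \<and> \<bar>k\<bar> \<le> 1)"

definition box :: "nat \<Rightarrow> int \<Rightarrow> int \<Rightarrow> (int \<times> int \<times> nat) set" where
  "box n lo hi = {lo..<hi} \<times> {lo..<hi} \<times> {..<n}"

lemma finite_box: "finite (box n lo hi)" by (simp add: box_def)

lemma card_box: "lo \<le> hi \<Longrightarrow> real (card (box n lo hi)) = n * (hi - lo)\<^sup>2"
  by (simp add: box_def card_cartesian_product power2_eq_square)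

lemma lap_support:
  assumes "near n es" "\<forall>v. v \<notin> box n lo hi \<longrightarrow> f v = 0" "v \<notin> box n (lo - 1) (hi + 1)"
  shows "lap es s f v = 0"
  using assms(1)
proof (induction es)
  case (Cons e es)
  obtain i j m k where e: "e = (i, j, m, k)" by (cases e) auto
  obtain p r l where v: "v = (p, r, l)" by (cases v) auto
  have b: "i < n" "j < n" "\<bar>m\<bar> \<le> 1" "\<bar>k\<bar> \<le> 1" using Cons.prems by (auto simp: near_def e)
  have "v \<notin> box n lo hi" "i = l \<Longrightarrow> (p + m, r + k, j) \<notin> box n lo hi"
    "j = l \<Longrightarrow> (p - m, r - k, i) \<notin> box n lo hi"
    using assms(3) b unfolding v box_def by auto
  then have "f v = 0" "i = l \<Longrightarrow> f (p + m, r + k, j) = 0" "j = l \<Longrightarrow> f (p - m, r - k, i) = 0"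
    using assms(2) by blast+
  then have "lap_term s f v e = 0" by (auto simp: lap_term_def v e)
  moreover have "near n es" using Cons.prems by (simp add: near_def)
  ultimately show ?case using Cons.IH by (simp add: lap_Cons)
qed (simp add: lap_Nil)

text \<open>As \<open>s\<close> is complex, the operator is symmetric but in general not Hermitian;
  hence a bilinear pairing without conjugation. The extra layer of \<open>B\<close> contains all
  neighbours of \<open>x\<close>, so nothing is lost by the finite sum.\<close>

lemma lap_symmetric:
  assumes "near n es" "x \<in> box n lo hi" "B = box n (lo - 1) (hi + 1)"
  shows "(\<Sum>v\<in>B. lap es s (\<lambda>w. if w = x then 1 else 0) v * u v) = lap es s u x"
  using assms(1)
proof (induction es)
  case (Cons e es)
  let ?\<delta> = "\<lambda>w. if w = x then 1 else 0 :: complex"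
  obtain i j m k where e: "e = (i, j, m, k)" by (cases e) auto
  obtain p r l where x: "x = (p, r, l)" by (cases x) auto
  have b: "i < n" "j < n" "\<bar>m\<bar> \<le> 1" "\<bar>k\<bar> \<le> 1" using Cons.prems by (auto simp: near_def e)
  have B: "finite B" "x \<in> B" "(p - m, r - k, i) \<in> B" "(p + m, r + k, j) \<in> B"
    using assms(2,3) b unfolding x by (auto simp: box_def)
  have "lap_term s ?\<delta> v e * u v
      = (if v = (p - m, r - k, i) then if j = l then u v else 0 else 0)
        + (if v = (p + m, r + k, j) then if i = l then u v else 0 else 0)
        - (if v = x then (if i = l then s * u v else 0) + (if j = l then s * u v else 0) else 0)" for v
    by (cases v) (auto simp: lap_term_def e x algebra_simps)
  then have "(\<Sum>v\<in>B. lap_term s ?\<delta> v e * u v) = lap_term s u x e"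
    using B by (simp add: sum.distrib sum_subtractf) (auto simp: lap_term_def e x)
  moreover have "near n es" using Cons.prems by (simp add: near_def)
  ultimately show ?case using Cons.IH by (simp add: lap_Cons distrib_right sum.distrib)
qed (simp add: lap_Nil)

lemma norm_sum_mult_le:
  fixes f g :: "'a \<Rightarrow> complex"
  shows "(norm (\<Sum>v\<in>B. f v * g v))\<^sup>2 \<le> (\<Sum>v\<in>B. (norm (f v))\<^sup>2) * (\<Sum>v\<in>B. (norm (g v))\<^sup>2)"
proof -
  have "norm (\<Sum>v\<in>B. f v * g v) \<le> (\<Sum>v\<in>B. norm (f v) * norm (g v))"
    by (rule order_trans[OF norm_sum]) (simp add: norm_mult)
  then have "(norm (\<Sum>v\<in>B. f v * g v))\<^sup>2 \<le> (\<Sum>v\<in>B. norm (f v) * norm (g v))\<^sup>2"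
    by (intro power_mono) auto
  also have "\<dots> \<le> (\<Sum>v\<in>B. (norm (f v))\<^sup>2) * (\<Sum>v\<in>B. (norm (g v))\<^sup>2)"
    by (rule Cauchy_Schwarz_ineq_sum)
  finally show ?thesis .
qed

text \<open>Triples with index at least \<open>n\<close> are not vertices and meet no edge; without
  the condition on them a point mass there would be a spurious kernel element.\<close>

definition finite_kernel_trivial :: "nat \<Rightarrow> per_graph \<Rightarrow> complex \<Rightarrow> bool" where
  "finite_kernel_trivial n es s \<longleftrightarrow> (\<forall>f. finite {v. f v \<noteq> 0} \<longrightarrow> (\<forall>p r i. n \<le> i \<longrightarrow> f (p, r, i) = 0) \<longrightarrow>
     lap es s f = (\<lambda>v. 0) \<longrightarrow> f = (\<lambda>v. 0))"

lemma no_l2_kernel: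
  assumes near: "near n es" and triv: "finite_kernel_trivial n es s"
    and u: "\<And>v. lap es s u v = 0"
    and M: "\<And>V. \<lbrakk>finite V; V \<subseteq> UNIV \<times> UNIV \<times> {..<n}\<rbrakk> \<Longrightarrow> (\<Sum>v\<in>V. (norm (u v))\<^sup>2) \<le> M"
    and i: "i < n"
  shows "u (p, r, i) = 0"
proof -
  have M0: "0 \<le> M" using M[of "{}"] by simp
  \<comment> \<open>The 8 arises from (N + 2)^2 - N^2 = 4 N + 4 <= 8 N.\<close>
  have est: "(norm (u (p, r, i)))\<^sup>2 * real N \<le> 8 * real n * M" if N: "N \<ge> 1" for N :: nat
  proof -
    define J where "J = box n 0 (int N)"
    define B where "B = box n (0 - 1) (int N + 1)"
    \<comment> \<open>\<open>A\<close> lies in a single translation orbit, that of the vertex to be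
      treated, so every point mass selected from it can be reached by a lattice shift.\<close>
    define A where "A = {0..<int N} \<times> {0..<int N} \<times> {i}"
    have fin: "finite J" "finite B" by (auto simp: J_def B_def finite_box)
    have "\<exists>b\<in>A. \<exists>f. (\<forall>j. j \<notin> J \<longrightarrow> f j = 0) \<and>
       real (card A) * (\<Sum>v\<in>B. (norm ((if v = b then 1 else 0) - lap es s f v))\<^sup>2)
         \<le> real (card B) - real (card J)"
    proof (rule lap.point_mass_near_range[OF fin(2,1)])
      fix f :: "int \<times> int \<times> nat \<Rightarrow> complex" and v
      assume "\<forall>j. j \<notin> J \<longrightarrow> f j = 0" "v \<notin> B"
      then show "lap es s f v = 0"
        using lap_support[OF near, of 0 "int N" f v s] unfolding J_def B_def by blast
    next
      fix f :: "int \<times> int \<times> nat \<Rightarrow> complex"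
      assume f: "\<forall>j. j \<notin> J \<longrightarrow> f j = 0" "lap es s f = (\<lambda>v. 0)"
      have "finite {v. f v \<noteq> 0}" using f(1) by (intro finite_subset[OF _ fin(1)]) auto
      moreover have "\<forall>p r i. n \<le> i \<longrightarrow> f (p, r, i) = 0" using f(1) by (auto simp: J_def box_def)
      ultimately show "f = (\<lambda>v. 0)" using triv f(2) unfolding finite_kernel_trivial_def by blast
    qed (use N i in \<open>auto simp: A_def B_def box_def\<close>)
    then obtain b f where b: "b \<in> A" and f: "\<forall>j. j \<notin> J \<longrightarrow> f j = 0"
      and bd: "real (card A) * (\<Sum>v\<in>B. (norm ((if v = b then 1 else 0) - lap es s f v))\<^sup>2)
         \<le> real (card B) - real (card J)" by blast
    define D where "D = (\<Sum>v\<in>B. (norm ((if v = b then 1 else 0) - lap es s f v))\<^sup>2)"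
    obtain p' r' where b': "b = (p', r', i)" using b by (auto simp: A_def)
    \<comment> \<open>The trace estimate does not control which \<open>b\<close> it finds.
      Translating \<open>u\<close> carries the value at \<open>(p, r, i)\<close> to \<open>b\<close>
      and preserves both the kernel equation and the bound \<open>M\<close>.\<close>
    define w where "w = (\<lambda>(x, y, l). u (x + (p - p'), y + (r - r'), l))"
    have w0: "lap es s w x = 0" for x
      using lap_shift[of es s u "p - p'" "r - r'"] u unfolding w_def by (cases x) simp
    have ff: "f = (\<lambda>v. \<Sum>x\<in>J. f x * (if v = x then 1 else 0))"
      using f fin(1) by (auto simp: fun_eq_iff if_distrib cong: if_cong)
    have Lf: "lap es s f v = (\<Sum>x\<in>J. f x * lap es s (\<lambda>w. if w = x then 1 else 0) v)" for v
      by (subst ff) (simp add: lap.sum[OF fin(1), of es s f "\<lambda>x w. if w = x then 1 else 0"])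
    have "(\<Sum>v\<in>B. lap es s f v * w v)
        = (\<Sum>x\<in>J. f x * (\<Sum>v\<in>B. lap es s (\<lambda>w. if w = x then 1 else 0) v * w v))"
      unfolding Lf sum_distrib_right sum_distrib_left mult.assoc by (rule sum.swap)
    also have "\<dots> = (\<Sum>x\<in>J. f x * lap es s w x)"
      using lap_symmetric[OF near _ B_def, of _ s w] unfolding J_def by (intro sum.cong) auto
    finally have 0: "(\<Sum>v\<in>B. lap es s f v * w v) = 0" using w0 by simp
    have bB: "b \<in> B" using b i by (auto simp: A_def B_def box_def)
    have "((if v = b then 1 else 0) - lap es s f v) * w v
        = (if v = b then w v else 0) - lap es s f v * w v" for v
      by (simp add: left_diff_distrib)
    \<comment> \<open>Since \<open>w\<close> annihilates the range, pairing it with the small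
      difference between point mass and range element returns the full value at
      \<open>b\<close>.\<close>
    then have "(\<Sum>v\<in>B. ((if v = b then 1 else 0) - lap es s f v) * w v)
        = (\<Sum>v\<in>B. if v = b then w v else 0)"
      using 0 by (simp add: sum_subtractf)
    also have "\<dots> = u (p, r, i)" using bB fin(2) by (simp add: w_def b')
    finally have "(norm (u (p, r, i)))\<^sup>2 \<le> D * (\<Sum>v\<in>B. (norm (w v))\<^sup>2)"
      unfolding D_def by (metis norm_sum_mult_le)
    also have "(\<Sum>v\<in>B. (norm (w v))\<^sup>2) \<le> M"
    proof -
      define T where "T = (\<lambda>(x, y, l :: nat). (x + (p - p'), y + (r - r'), l))"
      have "inj_on T B" by (auto simp: inj_on_def T_def)
      then have "(\<Sum>v\<in>B. (norm (w v))\<^sup>2) = (\<Sum>v\<in>T ` B. (norm (u v))\<^sup>2)"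
        by (subst sum.reindex) (auto simp: w_def T_def intro!: sum.cong)
      also have "\<dots> \<le> M" by (rule M) (use fin(2) in \<open>auto simp: T_def B_def box_def\<close>)
      finally show ?thesis .
    qed
    finally have 1: "(norm (u (p, r, i)))\<^sup>2 \<le> D * M"
      by (simp add: D_def mult_left_mono sum_nonneg)
    \<comment> \<open>the codimension \<open>card B - card J\<close> is only linear in \<open>N\<close>, whereas \<open>card A = N\<^sup>2\<close>\<close>
    have "real (card A) = (real N)\<^sup>2"
      by (simp add: A_def card_cartesian_product power2_eq_square)
    moreover have "real (card B) - real (card J) = real n * (4 * real N + 4)"
      unfolding B_def J_def by (simp add: card_box algebra_simps power2_eq_square)
    ultimately have "(real N)\<^sup>2 * D \<le> real n * (4 * real N + 4)" using bd unfolding D_def by simp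
    also have "\<dots> \<le> real n * (8 * real N)" using N by (intro mult_left_mono) auto
    finally have "real N * (real N * D) \<le> real N * (8 * real n)"
      by (simp add: power2_eq_square ac_simps)
    then have "real N * D \<le> 8 * real n" using N by simp
    then have "real N * D * M \<le> 8 * real n * M" using M0 by (rule mult_right_mono)
    moreover have "(norm (u (p, r, i)))\<^sup>2 * real N \<le> D * M * real N"
      using 1 by (intro mult_right_mono) auto
    ultimately show ?thesis by (simp add: ac_simps)
  qed
  show ?thesis
  proof (rule ccontr)
    assume "u (p, r, i) \<noteq> 0"
    then have pos: "(norm (u (p, r, i)))\<^sup>2 > 0" by simp
    obtain N :: nat where "8 * real n * M / (norm (u (p, r, i)))\<^sup>2 < real N"
      using reals_Archimedean2 by blast
    moreover have "real N \<le> real (max 1 N)" by simp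
    ultimately have "8 * real n * M / (norm (u (p, r, i)))\<^sup>2 < real (max 1 N)" by linarith
    then have "8 * real n * M < (norm (u (p, r, i)))\<^sup>2 * real (max 1 N)"
      using pos by (simp only: pos_divide_less_eq mult.commute)
    moreover have "(norm (u (p, r, i)))\<^sup>2 * real (max 1 N) \<le> 8 * real n * M"
      by (rule est) simp
    ultimately show False by linarith
  qed
qed

section \<open>Finitely supported kernels of the five tilings\<close>

lemma peel:
  fixes f :: "int \<times> int \<times> nat \<Rightarrow> complex" and h :: "int \<times> int \<times> nat \<Rightarrow> int"
  assumes fin: "finite {v. f v \<noteq> 0}"
    and step: "\<And>p r i. (\<And>p' r' i'. h (p', r', i') < h (p, r, i) \<Longrightarrow> f (p', r', i') = 0) \<Longrightarrow> f (p, r, i) = 0"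
  shows "f = (\<lambda>v. 0)"
proof (rule ccontr)
  assume "f \<noteq> (\<lambda>v. 0)"
  then have ne: "{v. f v \<noteq> 0} \<noteq> {}" by auto
  obtain v where v: "f v \<noteq> 0" "\<And>v'. f v' \<noteq> 0 \<Longrightarrow> h v \<le> h v'"
    using arg_min_if_finite(1)[OF fin ne, of h] arg_min_least[OF fin ne, of _ h] by blast
  obtain p r i where "v = (p, r, i)" by (cases v) auto
  then show False using v step[of p r i] by (metis not_le)
qed

text \<open>Each vertex \<open>v\<close> has a neighbour at which \<open>v\<close> is the highest vertex of the closed neighbourhood,
  so the equation there forces a finitely supported kernel element to vanish at its lowest vertex.
  The height is \<open>20 p + 10 r + \<beta> ! i\<close> and \<open>w ! i\<close> is the offset of that neighbour.\<close>

lemma peel_kernel: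
  fixes \<beta> :: "int list" and w :: "(int \<times> int \<times> nat) list"
  assumes "\<And>f p r i. \<lbrakk>i < n; \<And>p' r' i'. 20 * p' + 10 * r' + \<beta> ! i' < 20 * p + 10 * r + \<beta> ! i \<Longrightarrow>
      f (p', r', i') = 0\<rbrakk> \<Longrightarrow> case w ! i of (m, k, j) \<Rightarrow> lap es s f (p + m, r + k, j) = f (p, r, i)"
  shows "finite_kernel_trivial n es s"
  unfolding finite_kernel_trivial_def
proof (intro allI impI)
  fix f :: "int \<times> int \<times> nat \<Rightarrow> complex"
  assume fin: "finite {v. f v \<noteq> 0}" and idx: "\<forall>p r i. n \<le> i \<longrightarrow> f (p, r, i) = 0"
    and ker: "lap es s f = (\<lambda>v. 0)"
  show "f = (\<lambda>v. 0)"
  proof (rule peel[OF fin, of "\<lambda>(p, r, i). 20 * p + 10 * r + \<beta> ! i"])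
    fix p r i
    assume low: "\<And>p' r' i'. (case (p', r', i') of (p, r, i) \<Rightarrow> 20 * p + 10 * r + \<beta> ! i)
      < (case (p, r, i) of (p, r, i) \<Rightarrow> 20 * p + 10 * r + \<beta> ! i) \<Longrightarrow> f (p', r', i') = 0"
    show "f (p, r, i) = 0"
    proof (cases "i < n")
      case True
      have "case w ! i of (m, k, j) \<Rightarrow> lap es s f (p + m, r + k, j) = f (p, r, i)"
        by (rule assms[OF True]) (rule low, simp)
      then show ?thesis using ker by (simp split: prod.splits)
    qed (use idx in simp)
  qed
qed

text \<open>The slopes 20 and 10 tilt the height along the two lattice directions, and
  \<open>\<beta>\<close> orders the vertices of a cell so that finitely many strict inequalities
  hold. The centre \<open>w ! i\<close> of the neighbourhood is itself lower than the vertex peeled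
  off, so the term with \<open>s\<close> vanishes and the argument is uniform in \<open>s\<close>.
  The next three tilings follow the same pattern.\<close>

lemma snubSq_kernel: "finite_kernel_trivial 4 snubSq_graph s"
proof (rule peel_kernel[where \<beta> = "[0, 1, 2, 13]"
      and w = "[(- 1, 0, 2), (- 1, 0, 3), (0, 0, 0), (0, 0, 1)]"])
  fix f :: "int \<times> int \<times> nat \<Rightarrow> complex" and p r :: int and i :: nat
  let ?\<beta> = "[0, 1, 2, 13] :: int list"
  assume i: "i < 4" and low: "\<And>p' r' i'. 20 * p' + 10 * r' + ?\<beta> ! i' < 20 * p + 10 * r + ?\<beta> ! i \<Longrightarrow>
    f (p', r', i') = 0"
  from i consider "i = 0" | "i = 1" | "i = 2" | "i = 3" by linarith
  then show "case [(- 1, 0, 2), (- 1, 0, 3), (0, 0, 0), (0, 0, 1)] ! i of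
      (m, k, j) \<Rightarrow> lap snubSq_graph s f (p + m, r + k, j) = f (p, r, i)"
    by cases (use low in \<open>simp_all add: lap_def lap_term_def snubSq_graph_def\<close>)
qed

lemma rhombi_kernel: "finite_kernel_trivial 6 rhombi_graph s"
proof (rule peel_kernel[where \<beta> = "[0, 0, 1, 2, 2, 11]"
      and w = "[(- 1, 0, 4), (- 1, 0, 5), (0, 0, 0), (0, 0, 1), (0, 0, 2), (0, 0, 3)]"])
  fix f :: "int \<times> int \<times> nat \<Rightarrow> complex" and p r :: int and i :: nat
  let ?\<beta> = "[0, 0, 1, 2, 2, 11] :: int list"
  assume i: "i < 6" and low: "\<And>p' r' i'. 20 * p' + 10 * r' + ?\<beta> ! i' < 20 * p + 10 * r + ?\<beta> ! i \<Longrightarrow>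
    f (p', r', i') = 0"
  from i consider "i = 0" | "i = 1" | "i = 2" | "i = 3" | "i = 4" | "i = 5" by linarith
  then show "case [(- 1, 0, 4), (- 1, 0, 5), (0, 0, 0), (0, 0, 1), (0, 0, 2), (0, 0, 3)] ! i of
      (m, k, j) \<Rightarrow> lap rhombi_graph s f (p + m, r + k, j) = f (p, r, i)"
    by cases (use low in \<open>simp_all add: lap_def lap_term_def rhombi_graph_def\<close>)
qed

lemma snubTH_kernel: "finite_kernel_trivial 6 snubTH_graph s"
proof (rule peel_kernel[where \<beta> = "[0, 1, 2, 5, 4, 13]"
      and w = "[(- 1, 0, 4), (- 1, 0, 5), (0, 0, 0), (0, 0, 1), (0, 0, 2), (0, 0, 3)]"])
  fix f :: "int \<times> int \<times> nat \<Rightarrow> complex" and p r :: int and i :: nat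
  let ?\<beta> = "[0, 1, 2, 5, 4, 13] :: int list"
  assume i: "i < 6" and low: "\<And>p' r' i'. 20 * p' + 10 * r' + ?\<beta> ! i' < 20 * p + 10 * r + ?\<beta> ! i \<Longrightarrow>
    f (p', r', i') = 0"
  from i consider "i = 0" | "i = 1" | "i = 2" | "i = 3" | "i = 4" | "i = 5" by linarith
  then show "case [(- 1, 0, 4), (- 1, 0, 5), (0, 0, 0), (0, 0, 1), (0, 0, 2), (0, 0, 3)] ! i of
      (m, k, j) \<Rightarrow> lap snubTH_graph s f (p + m, r + k, j) = f (p, r, i)"
    by cases (use low in \<open>simp_all add: lap_def lap_term_def snubTH_graph_def\<close>)
qed

lemma trTH_kernel: "finite_kernel_trivial 12 trTH_graph s"
proof (rule peel_kernel[where \<beta> = "[0, 1, 0, 2, 1, 3, 4, 4, 5, 5, 12, 13]"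
      and w = "[(- 1, 0, 9), (0, 0, 0), (- 1, 0, 11), (0, 0, 1), (0, 0, 2), (0, 0, 3), (0, 0, 4), (0, 0, 5), (0, 0, 6), (0, 0, 7), (0, 0, 8), (0, 0, 10)]"])
  fix f :: "int \<times> int \<times> nat \<Rightarrow> complex" and p r :: int and i :: nat
  let ?\<beta> = "[0, 1, 0, 2, 1, 3, 4, 4, 5, 5, 12, 13] :: int list"
  assume i: "i < 12" and low: "\<And>p' r' i'. 20 * p' + 10 * r' + ?\<beta> ! i' < 20 * p + 10 * r + ?\<beta> ! i \<Longrightarrow>
    f (p', r', i') = 0"
  from i have "i = 0 \<or> i = 1 \<or> i = 2 \<or> i = 3 \<or> i = 4 \<or> i = 5 \<or> i = 6 \<or> i = 7 \<or> i = 8 \<or> i = 9 \<or> i = 10 \<or> i = 11"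
    by presburger
  then consider "i = 0" | "i = 1" | "i = 2" | "i = 3" | "i = 4" | "i = 5" | "i = 6" | "i = 7" | "i = 8" | "i = 9" | "i = 10" | "i = 11" by blast
  then show "case [(- 1, 0, 9), (0, 0, 0), (- 1, 0, 11), (0, 0, 1), (0, 0, 2), (0, 0, 3), (0, 0, 4), (0, 0, 5), (0, 0, 6), (0, 0, 7), (0, 0, 8), (0, 0, 10)] ! i of
      (m, k, j) \<Rightarrow> lap trTH_graph s f (p + m, r + k, j) = f (p, r, i)"
    by cases (use low in \<open>simp_all add: lap_def lap_term_def trTH_graph_def\<close>)
qed

text \<open>Here the peeling argument applies not to \<open>f\<close> but to its sums \<open>T\<close> over the triangles, which
  satisfy an equation on the hexagonal lattice and determine \<open>f\<close> unless \<open>\<mu> (\<mu> + 2) = 0\<close>.\<close>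

lemma trH_kernel:
  assumes s: "s \<noteq> 0" "s \<noteq> - 2 / 3"
  shows "finite_kernel_trivial 6 trH_graph s"
  unfolding finite_kernel_trivial_def
proof (intro allI impI)
  fix f :: "int \<times> int \<times> nat \<Rightarrow> complex"
  assume fin: "finite {v. f v \<noteq> 0}" and idx: "\<forall>p r i. 6 \<le> i \<longrightarrow> f (p, r, i) = 0"
    and ker: "lap trH_graph s f = (\<lambda>v. 0)"
  \<comment> \<open>All degrees are 3, so \<open>\<mu>\<close> is the adjacency eigenvalue.\<close>
  define \<mu> where "\<mu> = 3 * s"
  have "\<mu> + 2 \<noteq> 0"
  proof
    assume "\<mu> + 2 = 0"
    then have "s * 3 = - 2" by (simp add: \<mu>_def eq_neg_iff_add_eq_0 mult.commute)
    then have "s * 3 / 3 = - 2 / 3" by (simp only:)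
    then show False using s(2) by simp
  qed
  then have \<mu>: "\<mu> * (\<mu> + 2) \<noteq> 0" using s(1) by (simp add: \<mu>_def)
  define T where "T = (\<lambda>(p, r, t). if t = 0 then f (p, r, 0) + f (p, r, 1) + f (p, r, 2)
     else if t = (1::nat) then f (p, r, 3) + f (p, r, 4) + f (p, r, 5) else 0)"
  note defs = lap_def lap_term_def trH_graph_def
  have e0: "T (p, r, 0) - f (p, r, 0) + f (p - 1, r, 5) = \<mu> * f (p, r, 0)" for p r
    using fun_cong[OF ker, of "(p, r, 0)"] by (simp add: defs T_def \<mu>_def algebra_simps)
  have e1: "T (p, r, 0) - f (p, r, 1) + f (p, r - 1, 4) = \<mu> * f (p, r, 1)" for p r
    using fun_cong[OF ker, of "(p, r, 1)"] by (simp add: defs T_def \<mu>_def algebra_simps)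
  have e2: "T (p, r, 0) - f (p, r, 2) + f (p, r, 3) = \<mu> * f (p, r, 2)" for p r
    using fun_cong[OF ker, of "(p, r, 2)"] by (simp add: defs T_def \<mu>_def algebra_simps)
  have e3: "T (p, r, 1) - f (p, r, 3) + f (p, r, 2) = \<mu> * f (p, r, 3)" for p r
    using fun_cong[OF ker, of "(p, r, 3)"] by (simp add: defs T_def \<mu>_def algebra_simps)
  have e4: "T (p, r, 1) - f (p, r, 4) + f (p, r + 1, 1) = \<mu> * f (p, r, 4)" for p r
    using fun_cong[OF ker, of "(p, r, 4)"] by (simp add: defs T_def \<mu>_def algebra_simps)
  have e5: "T (p, r, 1) - f (p, r, 5) + f (p + 1, r, 0) = \<mu> * f (p, r, 5)" for p r
    using fun_cong[OF ker, of "(p, r, 5)"] by (simp add: defs T_def \<mu>_def algebra_simps)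
  \<comment> \<open>Here \<open>x\<close> and \<open>y\<close> are the values at the ends of an edge
    joining two triangles with sums \<open>A\<close> and \<open>B\<close>. The system
    (\<open>\<mu>\<close> + 1) x - y = A, (\<open>\<mu>\<close> + 1) y - x = B has determinant
    \<open>\<mu> * (\<mu> + 2)\<close>.\<close>
  have pair: "\<mu> * (\<mu> + 2) * x = (\<mu> + 1) * A + B" if "A - x + y = \<mu> * x" "B - y + x = \<mu> * y" for A B x y
    using that by algebra
  have f0: "\<mu> * (\<mu> + 2) * f (p, r, 0) = (\<mu> + 1) * T (p, r, 0) + T (p - 1, r, 1)" for p r
    using pair[OF e0] e5[of "p - 1" r] by simp
  have f1: "\<mu> * (\<mu> + 2) * f (p, r, 1) = (\<mu> + 1) * T (p, r, 0) + T (p, r - 1, 1)" for p r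
    using pair[OF e1] e4[of p "r - 1"] by simp
  have f2: "\<mu> * (\<mu> + 2) * f (p, r, 2) = (\<mu> + 1) * T (p, r, 0) + T (p, r, 1)" for p r
    using pair[OF e2] e3 by simp
  have f3: "\<mu> * (\<mu> + 2) * f (p, r, 3) = (\<mu> + 1) * T (p, r, 1) + T (p, r, 0)" for p r
    using pair[OF e3] e2 by simp
  have f4: "\<mu> * (\<mu> + 2) * f (p, r, 4) = (\<mu> + 1) * T (p, r, 1) + T (p, r + 1, 0)" for p r
    using pair[OF e4] e1[of p "r + 1"] by simp
  have f5: "\<mu> * (\<mu> + 2) * f (p, r, 5) = (\<mu> + 1) * T (p, r, 1) + T (p + 1, r, 0)" for p r
    using pair[OF e5] e0[of "p + 1" r] by simp
  \<comment> \<open>Adding up over the corners of a triangle closes the equations on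
    \<open>T\<close>: an eigenvalue equation on the hexagonal lattice, one vertex per
    triangle.\<close>
  have T0: "\<mu> * (\<mu> + 2) * T (p, r, 0) = 3 * (\<mu> + 1) * T (p, r, 0) + T (p - 1, r, 1) + T (p, r - 1, 1) + T (p, r, 1)" for p r
  proof -
    have "\<mu> * (\<mu> + 2) * T (p, r, 0)
        = \<mu> * (\<mu> + 2) * f (p, r, 0) + \<mu> * (\<mu> + 2) * f (p, r, 1) + \<mu> * (\<mu> + 2) * f (p, r, 2)"
      by (simp add: T_def distrib_left)
    then show ?thesis unfolding f0 f1 f2 by (simp add: algebra_simps)
  qed
  have T1: "\<mu> * (\<mu> + 2) * T (p, r, 1) = 3 * (\<mu> + 1) * T (p, r, 1) + T (p, r, 0) + T (p, r + 1, 0) + T (p + 1, r, 0)" for p r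
  proof -
    have "\<mu> * (\<mu> + 2) * T (p, r, 1)
        = \<mu> * (\<mu> + 2) * f (p, r, 3) + \<mu> * (\<mu> + 2) * f (p, r, 4) + \<mu> * (\<mu> + 2) * f (p, r, 5)"
      by (simp add: T_def distrib_left)
    then show ?thesis unfolding f3 f4 f5 by (simp add: algebra_simps)
  qed
  \<comment> \<open>Each triangle is the strictly highest one in the closed neighbourhood of some
    adjacent triangle: \<open>(p, r, 0)\<close> around \<open>(p - 1, r, 1)\<close>, and
    \<open>(p, r, 1)\<close> around \<open>(p, r, 0)\<close>.\<close>
  define h :: "int \<times> int \<times> nat \<Rightarrow> int" where "h = (\<lambda>(p, r, i). 20 * p + 10 * r + 5 * int i)"
  have "T = (\<lambda>v. 0)"
  proof (rule peel[of _ h])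
    have "{v. T v \<noteq> 0} \<subseteq> (\<lambda>((p, r, i), t). (p, r, t)) ` ({v. f v \<noteq> 0} \<times> {0, 1})"
    proof clarify
      fix p r t assume nz: "T (p, r, t) \<noteq> 0"
      then have "t \<in> {0, 1}" by (auto simp: T_def split: if_splits)
      moreover from nz obtain i where "f (p, r, i) \<noteq> 0"
        unfolding T_def by (auto split: if_splits) (metis add.right_neutral)+
      ultimately show "(p, r, t) \<in> (\<lambda>((p, r, i), t). (p, r, t)) ` ({v. f v \<noteq> 0} \<times> {0, 1})"
        by (intro image_eqI[of _ _ "((p, r, i), t)"]) auto
    qed
    then show "finite {v. T v \<noteq> 0}" by (rule finite_subset) (use fin in simp)
    fix p r i assume low: "\<And>p' r' i'. h (p', r', i') < h (p, r, i) \<Longrightarrow> T (p', r', i') = 0"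
    consider "2 \<le> i" | "i = 0" | "i = 1" by linarith
    then show "T (p, r, i) = 0"
    proof cases
      case 1 then show ?thesis by (simp add: T_def)
    next
      case 2
      then have "T (p - 1, r, 1) = 0" "T (p - 1, r, 0) = 0" "T (p - 1, r + 1, 0) = 0"
        by (auto intro!: low simp: h_def)
      then show ?thesis using T1[of "p - 1" r] 2 by simp
    next
      case 3
      then have "T (p, r, 0) = 0" "T (p - 1, r, 1) = 0" "T (p, r - 1, 1) = 0"
        by (auto intro!: low simp: h_def)
      then show ?thesis using T0[of p r] 3 by simp
    qed
  qed
  then have Tz: "T v = 0" for v by simp
  \<comment> \<open>With \<open>T = 0\<close> the equations \<open>f0\<close> to \<open>f5\<close>
    read \<open>\<mu> * (\<mu> + 2) * f v = 0\<close>; here the two exceptional values of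
    \<open>s\<close> are excluded.\<close>
  show "f = (\<lambda>v. 0)"
  proof
    fix v :: "int \<times> int \<times> nat"
    obtain p r i where v: "v = (p, r, i)" by (cases v) auto
    consider "6 \<le> i" | "i = 0" | "i = 1" | "i = 2" | "i = 3" | "i = 4" | "i = 5" by linarith
    then show "f v = 0"
      using idx \<mu> f0[of p r] f1[of p r] f2[of p r] f3[of p r] f4[of p r] f5[of p r]
      unfolding v Tz by cases auto
  qed
qed

section \<open>Reduction of the spectral problem to the vertices\<close>

lemma sum_per_src:
  "(\<Sum>e\<in>{e \<in> per_E es. per_src es e = (p, r, l)}. g e)
    = (\<Sum>k<length es. case es ! k of (i, j, m, n) \<Rightarrow> if i = l then g (p, r, k) else 0)"
proof -
  have "{e \<in> per_E es. per_src es e = (p, r, l)}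
      = (\<lambda>k. (p, r, k)) ` {k \<in> {..<length es}. fst (es ! k) = l}"
    by (auto simp: per_E_def per_src_def image_iff case_prod_unfold)
  then have "(\<Sum>e\<in>{e \<in> per_E es. per_src es e = (p, r, l)}. g e)
      = (\<Sum>k\<in>{k \<in> {..<length es}. fst (es ! k) = l}. g (p, r, k))"
    by (simp add: sum.reindex inj_on_def)
  also have "\<dots> = (\<Sum>k<length es. if fst (es ! k) = l then g (p, r, k) else 0)"
    by (rule sum.inter_filter) simp
  finally show ?thesis by (simp add: case_prod_unfold)
qed

lemma sum_per_tgt:
  "(\<Sum>e\<in>{e \<in> per_E es. per_tgt es e = (p, r, l)}. g e)
    = (\<Sum>k<length es. case es ! k of (i, j, m, n) \<Rightarrow> if j = l then g (p - m, r - n, k) else 0)"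
proof -
  let ?h = "\<lambda>k. (p - fst (snd (snd (es ! k))), r - snd (snd (snd (es ! k))), k)"
  let ?K = "{k \<in> {..<length es}. fst (snd (es ! k)) = l}"
  have "{e \<in> per_E es. per_tgt es e = (p, r, l)} = ?h ` ?K"
    by (auto simp: per_E_def per_tgt_def image_iff case_prod_unfold)
  moreover have "inj_on ?h ?K" by (auto simp: inj_on_def)
  ultimately have "(\<Sum>e\<in>{e \<in> per_E es. per_tgt es e = (p, r, l)}. g e) = (\<Sum>k\<in>?K. g (?h k))"
    by (simp add: sum.reindex)
  also have "\<dots> = (\<Sum>k<length es. if fst (snd (es ! k)) = l then g (?h k) else 0)"
    by (rule sum.inter_filter) simp
  finally show ?thesis by (simp add: case_prod_unfold)
qed

lemma lap_eq_sum:
  "lap es s f v = (\<Sum>k<length es. lap_term s f v (es ! k))"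
  unfolding lap_def by (simp add: sum_list_sum_nth atLeast0LessThan)

text \<open>For \<open>c\<close> = S(a) and \<open>s\<close> = S'(a) the hypotheses are the boundary
  formulas of \<open>ode_sol_boundary\<close>. The identity serves both directions: from
  eigenfunctions to vertex functions and back.\<close>

lemma kirchhoff_eq_lap:
  assumes src: "\<And>e. e \<in> per_E es \<Longrightarrow> c * d0 e = f (per_tgt es e) - s * f (per_src es e)"
    and tgt: "\<And>e. e \<in> per_E es \<Longrightarrow> c * - d1 e = f (per_src es e) - s * f (per_tgt es e)"
  shows "c * ((\<Sum>e\<in>{e \<in> per_E es. per_src es e = v}. d0 e)
      - (\<Sum>e\<in>{e \<in> per_E es. per_tgt es e = v}. d1 e)) = lap es s f v"
proof -
  obtain p r l where v: "v = (p, r, l)" by (cases v) auto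
  have "c * ((\<Sum>e\<in>{e \<in> per_E es. per_src es e = v}. d0 e)
        - (\<Sum>e\<in>{e \<in> per_E es. per_tgt es e = v}. d1 e))
      = (\<Sum>e\<in>{e \<in> per_E es. per_src es e = v}. c * d0 e)
        + (\<Sum>e\<in>{e \<in> per_E es. per_tgt es e = v}. c * - d1 e)"
    by (simp add: right_diff_distrib sum_distrib_left sum_negf)
  also have "\<dots> = (\<Sum>k<length es. (case es ! k of (i, j, m, n) \<Rightarrow> if i = l then c * d0 (p, r, k) else 0)
      + (case es ! k of (i, j, m, n) \<Rightarrow> if j = l then c * - d1 (p - m, r - n, k) else 0))"
    unfolding v sum_per_src sum_per_tgt sum.distrib ..
  also have "\<dots> = (\<Sum>k<length es. lap_term s f v (es ! k))"
  proof (rule sum.cong[OF refl])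
    fix k assume k: "k \<in> {..<length es}"
    obtain i j m n where e: "es ! k = (i, j, m, n)" by (cases "es ! k") auto
    have "(x, y, k) \<in> per_E es" "per_src es (x, y, k) = (x, y, i)" "per_tgt es (x, y, k) = (x + m, y + n, j)"
      for x y using k e by (auto simp: per_E_def per_src_def per_tgt_def)
    then have "c * d0 (p, r, k) = f (p + m, r + n, j) - s * f (p, r, i)"
      "c * - d1 (p - m, r - n, k) = f (p - m, r - n, i) - s * f (p, r, j)"
      using src[of "(p, r, k)"] tgt[of "(p - m, r - n, k)"] by simp_all
    then show "(case es ! k of (i, j, m, n) \<Rightarrow> if i = l then c * d0 (p, r, k) else 0)
      + (case es ! k of (i, j, m, n) \<Rightarrow> if j = l then c * - d1 (p - m, r - n, k) else 0)
      = lap_term s f v (es ! k)"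
      unfolding e v lap_term_def by auto
  qed
  finally show ?thesis unfolding lap_eq_sum .
qed

lemma finite_edges_at:
  assumes "finite V"
  shows "finite {e \<in> per_E es. per_src es e \<in> V \<or> per_tgt es e \<in> V}"
proof (rule finite_subset)
  let ?b = "\<lambda>((p, r, l), k). case es ! k of (i, j, m, n) \<Rightarrow> (p - m, r - n, k)"
  let ?a = "\<lambda>((p, r, l), k). (p, r, k)"
  show "{e \<in> per_E es. per_src es e \<in> V \<or> per_tgt es e \<in> V}
      \<subseteq> ?a ` (V \<times> {..<length es}) \<union> ?b ` (V \<times> {..<length es})"
  proof clarify
    fix p r k assume k: "(p, r, k) \<in> per_E es"
      and *: "per_src es (p, r, k) \<in> V \<or> per_tgt es (p, r, k) \<in> V"
      and nb: "(p, r, k) \<notin> ?b ` (V \<times> {..<length es})"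
    obtain i j m n where e: "es ! k = (i, j, m, n)" by (cases "es ! k") auto
    have "per_tgt es (p, r, k) \<notin> V"
    proof
      assume "per_tgt es (p, r, k) \<in> V"
      then have "(p, r, k) \<in> ?b ` (V \<times> {..<length es})"
        using k e by (intro image_eqI[of _ _ "(per_tgt es (p, r, k), k)"])
          (auto simp: per_tgt_def per_E_def)
      then show False using nb by blast
    qed
    then have "per_src es (p, r, k) \<in> V" using * by blast
    then show "(p, r, k) \<in> ?a ` (V \<times> {..<length es})"
      using k e by (intro image_eqI[of _ _ "(per_src es (p, r, k), k)"])
        (auto simp: per_src_def per_E_def)
  qed
qed (use assms in simp)

lemma H2_norm2_zero: "H2_norm2 a (\<lambda>t. 0) (\<lambda>t. 0) (\<lambda>t. 0) = 0"
  by (simp add: H2_norm2_def set_lebesgue_integral_def)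

locale schrodinger_edge =
  fixes a :: real and q :: "real \<Rightarrow> real" and rho :: complex
  assumes a_pos: "a > 0"
    and q_meas: "q \<in> borel_measurable (lebesgue_on {0..a})"
    and q_L2: "integrable (lebesgue_on {0..a}) (\<lambda>x. (q x)\<^sup>2)"
    and q_even: "AE x in lebesgue_on {0..a}. q x = q (a - x)"
begin

definition Q :: "real \<Rightarrow> complex" where "Q t = complex_of_real (q t) - rho\<^sup>2"

lemma Q_L2: "L2_on {0..a} Q"
  unfolding L2_on_def
proof
  show m: "Q \<in> borel_measurable (lebesgue_on {0..a})"
    unfolding Q_def using q_meas by measurable
  have "(\<lambda>x. (q x)\<^sup>2) absolutely_integrable_on {0..a}"
    using q_L2 by (simp add: set_integrable_def integrable_restrict_space)
  then have i: "(\<lambda>x. (q x)\<^sup>2) integrable_on {0..a}"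
    by (rule set_lebesgue_integral_eq_integral(1))
  have "(\<lambda>t. (norm (Q t))\<^sup>2) absolutely_integrable_on {0..a}"
  proof (rule measurable_bounded_by_integrable_imp_absolutely_integrable)
    show "(\<lambda>t. (norm (Q t))\<^sup>2) \<in> borel_measurable (lebesgue_on {0..a})" using m by measurable
    show "(\<lambda>t. 2 * (q t)\<^sup>2 + 2 * (norm (rho\<^sup>2))\<^sup>2) integrable_on {0..a}"
      by (intro integrable_add integrable_on_mult_right i integrable_const_ivl)
    fix t
    have "norm (Q t) \<le> \<bar>q t\<bar> + norm (rho\<^sup>2)"
      unfolding Q_def by (rule order_trans[OF norm_triangle_ineq4]) simp
    then have "(norm (Q t))\<^sup>2 \<le> (\<bar>q t\<bar> + norm (rho\<^sup>2))\<^sup>2" by (intro power_mono) auto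
    also have "\<dots> \<le> 2 * (q t)\<^sup>2 + 2 * (norm (rho\<^sup>2))\<^sup>2"
      using sum_squares_bound[of "\<bar>q t\<bar>" "norm (rho\<^sup>2)"] by (simp add: power2_sum)
    finally show "norm ((norm (Q t))\<^sup>2) \<le> 2 * (q t)\<^sup>2 + 2 * (norm (rho\<^sup>2))\<^sup>2" by simp
  qed auto
  then show "(\<lambda>t. (norm (Q t))\<^sup>2) integrable_on {0..a}"
    by (rule set_lebesgue_integral_eq_integral(1))
qed

definition S :: "real \<Rightarrow> complex" where "S x = S_fun a q x rho"
definition S1 :: "real \<Rightarrow> complex" where "S1 x = S_der a q x rho"

lemma S: "ode_sol a Q S S1" "S 0 = 0" "S1 0 = 1"
  using S_pair_ode_sol[of a q rho] a_pos Q_L2 unfolding S_def[abs_def] S1_def[abs_def] Q_def[abs_def]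
  by auto

lemma Q_even: "AE t in lebesgue_on {0..a}. Q t = Q (a - t)"
  using q_even by eventually_elim (simp add: Q_def)

lemmas boundary = ode_sol_boundary[OF Q_L2 less_imp_le[OF a_pos] Q_even S]

lemma edge_equation_iff:
  "- z + complex_of_real (q t) * w = rho\<^sup>2 * w \<longleftrightarrow> z = Q t * w"
  by (auto simp: Q_def algebra_simps)

text \<open>With bounded support the summability condition is a finite sum, so only local conditions
  remain; \<open>f\<close> records the common vertex values.\<close>

lemma is_eigenfunctionI:
  assumes sol: "\<And>e. e \<in> per_E es \<Longrightarrow> ode_sol a Q (y e) (y1 e)"
    and fin: "finite F" "\<And>e. e \<in> per_E es - F \<Longrightarrow> y e = (\<lambda>t. 0) \<and> y1 e = (\<lambda>t. 0)"
    and cont: "\<And>e. e \<in> per_E es \<Longrightarrow> y e 0 = f (per_src es e) \<and> y e a = f (per_tgt es e)"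
    and kirch: "\<And>v. (\<Sum>e\<in>{e \<in> per_E es. per_src es e = v}. y1 e 0)
                   - (\<Sum>e\<in>{e \<in> per_E es. per_tgt es e = v}. y1 e a) = 0"
    and nz: "e0 \<in> per_E es" "t0 \<in> {0..a}" "y e0 t0 \<noteq> 0"
  shows "rho\<^sup>2 \<in> per_point_spectrum a q es"
proof -
  have "(\<lambda>e. H2_norm2 a (y e) (y1 e) (\<lambda>t. Q t * y e t)) summable_on per_E es"
  proof (rule summable_on_cong_neutral[THEN iffD1])
    show "(\<lambda>e. H2_norm2 a (y e) (y1 e) (\<lambda>t. Q t * y e t)) summable_on (F \<inter> per_E es)"
      using fin(1) by (intro summable_on_finite) simp
    show "H2_norm2 a (y e) (y1 e) (\<lambda>t. Q t * y e t) = 0" if "e \<in> per_E es - F \<inter> per_E es" for e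
    proof -
      have "y e = (\<lambda>t. 0) \<and> y1 e = (\<lambda>t. 0)" using fin(2) that by blast
      then show ?thesis by (simp add: H2_norm2_zero)
    qed
  qed auto
  then have "is_eigenfunction a q (per_E es) (per_src es) (per_tgt es) (rho\<^sup>2) y y1 (\<lambda>e t. Q t * y e t)"
    unfolding is_eigenfunction_def edge_equation_iff
  proof (intro conjI ballI allI)
    show "\<exists>c. \<forall>e\<in>per_E es. (per_src es e = v \<longrightarrow> y e 0 = c) \<and> (per_tgt es e = v \<longrightarrow> y e a = c)" for v
      using cont by (intro exI[of _ "f v"]) blast
    show "\<exists>e\<in>per_E es. \<exists>t\<in>{0..a}. y e t \<noteq> 0" using nz by blast
  qed (use ode_sol_H2_triple[OF Q_L2 sol] kirch in simp_all)
  then show ?thesis unfolding point_spectrum_def by blast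
qed

text \<open>Multiples of S vanish at both ends of every edge, so continuity is automatic. The
  outgoing derivatives of \<open>\<phi> e * S\<close> are \<open>\<phi> e\<close> at the source and
  \<open>- S1 a * \<phi> e\<close> at the target, which turns Kirchhoff's condition into
  \<open>flow\<close>.\<close>

lemma flow_eigenvalue:
  assumes S0: "S a = 0" and fin: "finite {e. \<phi> e \<noteq> 0}" and nz: "\<phi> e0 \<noteq> 0" "e0 \<in> per_E es"
    and flow: "\<And>v. (\<Sum>e\<in>{e \<in> per_E es. per_src es e = v}. \<phi> e)
      - S1 a * (\<Sum>e\<in>{e \<in> per_E es. per_tgt es e = v}. \<phi> e) = 0"
  shows "rho\<^sup>2 \<in> per_point_spectrum a q es"
proof -
  \<comment> \<open>If S vanished on [0,a], then S' would be constantly 1 and S(a) = a.\<close>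
  have "\<exists>t0\<in>{0..a}. S t0 \<noteq> 0"
  proof (rule ccontr)
    assume "\<not> ?thesis"
    then have z: "S t = 0" if "t \<in> {0..a}" for t using that by blast
    have one: "S1 x = 1" if x: "x \<in> {0..a}" for x
    proof -
      have "integral {0..x} (\<lambda>t. Q t * S t) = integral {0..x} (\<lambda>t. 0)"
        using x z by (intro integral_cong) auto
      then show ?thesis using ode_solD(4)[OF S(1) x] S(3) by simp
    qed
    have "S a = S 0 + integral {0..a} S1" using ode_solD(3)[OF S(1), of a] a_pos by simp
    also have "integral {0..a} S1 = integral {0..a} (\<lambda>t. 1)" using one by (intro integral_cong)
    finally show False using S0 S(2) a_pos by simp
  qed
  then obtain t0 where t0: "t0 \<in> {0..a}" "S t0 \<noteq> 0" by blast
  show ?thesis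
  proof (rule is_eigenfunctionI[where y = "\<lambda>e t. \<phi> e * S t" and ?y1.0 = "\<lambda>e t. \<phi> e * S1 t"
        and F = "{e. \<phi> e \<noteq> 0}" and f = "\<lambda>v. 0" and ?e0.0 = e0 and ?t0.0 = t0])
    show "ode_sol a Q (\<lambda>t. \<phi> e * S t) (\<lambda>t. \<phi> e * S1 t)" for e
      using ode_sol_linear[OF Q_L2 S(1) S(1), of "\<phi> e" 0] by simp
    show "(\<Sum>e\<in>{e \<in> per_E es. per_src es e = v}. \<phi> e * S1 0)
        - (\<Sum>e\<in>{e \<in> per_E es. per_tgt es e = v}. \<phi> e * S1 a) = 0" for v
      using flow[of v] S(3) by (simp add: sum_distrib_left mult.commute)
  qed (use fin nz t0 S0 S(2) in auto)
qed

text \<open>S(a) different from 0 lets any end values be prescribed; \<open>U\<close> and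
  \<open>W\<close> are the interpolating solutions for end values (1,0) and (0,1).\<close>

lemma finite_kernel_eigenvalue:
  assumes S0: "S a \<noteq> 0" and fin: "finite {v. f v \<noteq> 0}" and ker: "\<And>v. lap es (S1 a) f v = 0"
    and nz: "f (per_src es e0) \<noteq> 0" "e0 \<in> per_E es"
  shows "rho\<^sup>2 \<in> per_point_spectrum a q es"
proof -
  obtain U U1 where U: "ode_sol a Q U U1" "U 0 = 1" "U a = 0" using boundary(3)[OF S0] by blast
  obtain W W1 where W: "ode_sol a Q W W1" "W 0 = 0" "W a = 1" using boundary(3)[OF S0] by blast
  define y where "y = (\<lambda>e t. f (per_src es e) * U t + f (per_tgt es e) * W t)"
  define y1 where "y1 = (\<lambda>e t. f (per_src es e) * U1 t + f (per_tgt es e) * W1 t)"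
  have sol: "ode_sol a Q (y e) (y1 e)" for e
    unfolding y_def y1_def by (rule ode_sol_linear[OF Q_L2 U(1) W(1)])
  have ends: "y e 0 = f (per_src es e)" "y e a = f (per_tgt es e)" for e
    unfolding y_def using U W by simp_all
  show ?thesis
  proof (rule is_eigenfunctionI[where y = y and ?y1.0 = y1
        and F = "{e \<in> per_E es. per_src es e \<in> {v. f v \<noteq> 0} \<or> per_tgt es e \<in> {v. f v \<noteq> 0}}"
        and f = f and ?e0.0 = e0 and ?t0.0 = 0])
    fix v
    have "S a * ((\<Sum>e\<in>{e \<in> per_E es. per_src es e = v}. y1 e 0)
      - (\<Sum>e\<in>{e \<in> per_E es. per_tgt es e = v}. y1 e a)) = lap es (S1 a) f v"
      by (rule kirchhoff_eq_lap) (use boundary(1,2)[OF S0 sol] ends in simp_all)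
    then show "(\<Sum>e\<in>{e \<in> per_E es. per_src es e = v}. y1 e 0)
      - (\<Sum>e\<in>{e \<in> per_E es. per_tgt es e = v}. y1 e a) = 0" using ker S0 by simp
  qed (use sol ends finite_edges_at[OF fin] nz a_pos in \<open>auto simp: y_def y1_def\<close>)
qed

text \<open>The vertex values of an eigenfunction form a square summable kernel element, which
  \<open>no_l2_kernel\<close> annihilates if the finitely supported kernel is trivial. An edge
  solution with zero end values then vanishes, as S(a) is not 0.\<close>

lemma eigenvalue_not_trivial_kernel:
  assumes ev: "rho\<^sup>2 \<in> per_point_spectrum a q es" and S0: "S a \<noteq> 0" and near: "near n es"
    and out: "\<And>i. i < n \<Longrightarrow> i \<in> fst ` set es"
  shows "\<not> finite_kernel_trivial n es (S1 a)"
proof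
  assume triv: "finite_kernel_trivial n es (S1 a)"
  obtain y y1 y2 where "is_eigenfunction a q (per_E es) (per_src es) (per_tgt es) (rho\<^sup>2) y y1 y2"
    using ev unfolding point_spectrum_def by blast
  then have H2: "\<And>e. e \<in> per_E es \<Longrightarrow> H2_triple a (y e) (y1 e) (y2 e)"
    and summ: "(\<lambda>e. H2_norm2 a (y e) (y1 e) (y2 e)) summable_on per_E es"
    and cont: "\<forall>v. \<exists>c. \<forall>e\<in>per_E es. (per_src es e = v \<longrightarrow> y e 0 = c) \<and> (per_tgt es e = v \<longrightarrow> y e a = c)"
    and kirch: "\<And>v. (\<Sum>e\<in>{e \<in> per_E es. per_src es e = v}. y1 e 0)
                   - (\<Sum>e\<in>{e \<in> per_E es. per_tgt es e = v}. y1 e a) = 0"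
    and ode: "\<And>e. e \<in> per_E es \<Longrightarrow> AE t in lebesgue. t \<in> {0..a} \<longrightarrow> y2 e t = Q t * y e t"
    and nz: "\<exists>e\<in>per_E es. \<exists>t\<in>{0..a}. y e t \<noteq> 0"
    unfolding is_eigenfunction_def edge_equation_iff by blast+
  \<comment> \<open>\<open>f\<close> is arbitrary at triples that are not vertices, hence the later
    restriction to indices below \<open>n\<close>.\<close>
  obtain f where f: "\<And>e. e \<in> per_E es \<Longrightarrow> y e 0 = f (per_src es e)"
    "\<And>e. e \<in> per_E es \<Longrightarrow> y e a = f (per_tgt es e)"
    using choice[OF cont] by blast
  have sol: "ode_sol a Q (y e) (y1 e)" if "e \<in> per_E es" for e
    by (rule H2_triple_ode_sol[OF H2[OF that] Q_L2 ode[OF that]])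
  have ker: "lap es (S1 a) f v = 0" for v
  proof -
    have "S a * ((\<Sum>e\<in>{e \<in> per_E es. per_src es e = v}. y1 e 0)
      - (\<Sum>e\<in>{e \<in> per_E es. per_tgt es e = v}. y1 e a)) = lap es (S1 a) f v"
      by (rule kirchhoff_eq_lap) (use boundary(1,2)[OF S0 sol] f in simp_all)
    then show ?thesis using kirch[of v] by simp
  qed
  define H where "H = (\<lambda>e. H2_norm2 a (y e) (y1 e) (y2 e))"
  have H0: "0 \<le> H e" if "e \<in> per_E es" for e
    unfolding H_def using H2_norm2_bounds(1)[OF H2[OF that]] a_pos by simp
  define c where "c = (2 + 2 * a\<^sup>2) / a"
  have c0: "c \<ge> 0" using a_pos by (simp add: c_def)
  have val: "(norm (y e 0))\<^sup>2 \<le> c * H e" if "e \<in> per_E es" for e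
    using H2_norm2_bounds(2)[OF H2[OF that]] a_pos unfolding H_def c_def by (simp add: field_simps)
  have "\<exists>k<length es. fst (es ! k) = i" if "i < n" for i
  proof -
    have "i \<in> fst ` set es" using out that .
    then obtain x where "x \<in> set es" "fst x = i" by blast
    then show ?thesis unfolding in_set_conv_nth by blast
  qed
  then obtain \<kappa> where \<kappa>: "\<And>i. i < n \<Longrightarrow> \<kappa> i < length es \<and> fst (es ! \<kappa> i) = i" by metis
  \<comment> \<open>One outgoing edge per vertex, available by \<open>out\<close>. Its source
    recovers the vertex, so distinct vertices use distinct edges and each edge norm is counted at
    most once.\<close>
  define ed where "ed = (\<lambda>(p :: int, r :: int, i). (p, r, \<kappa> i))"
  have ed: "ed v \<in> per_E es" "per_src es (ed v) = v" if "v \<in> UNIV \<times> UNIV \<times> {..<n}" for v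
    using that \<kappa>[of "snd (snd v)"]
    by (auto simp: ed_def per_E_def per_src_def case_prod_unfold)
  have bound: "(\<Sum>v\<in>V. (norm (f v))\<^sup>2) \<le> c * infsum H (per_E es)"
    if V: "finite V" "V \<subseteq> UNIV \<times> UNIV \<times> {..<n}" for V
  proof -
    have inj: "inj_on ed V" using ed(2) V(2) by (metis inj_onI subsetD)
    have "(\<Sum>v\<in>V. (norm (f v))\<^sup>2) \<le> (\<Sum>v\<in>V. c * H (ed v))"
    proof (rule sum_mono)
      fix v assume "v \<in> V"
      then have v: "v \<in> UNIV \<times> UNIV \<times> {..<n}" using V(2) by blast
      show "(norm (f v))\<^sup>2 \<le> c * H (ed v)"
        using val[OF ed(1)[OF v]] unfolding f(1)[OF ed(1)[OF v]] ed(2)[OF v] .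
    qed
    also have "\<dots> = c * (\<Sum>e\<in>ed ` V. H e)" by (simp add: sum.reindex[OF inj] sum_distrib_left)
    also have "\<dots> \<le> c * infsum H (per_E es)"
    proof (intro mult_left_mono c0 finite_sum_le_infsum)
      show "H summable_on per_E es" using summ unfolding H_def .
      show "ed ` V \<subseteq> per_E es" using ed(1) V(2) by blast
    qed (use V(1) H0 in auto)
    finally show ?thesis .
  qed
  have zero: "f (p, r, i) = 0" if "i < n" for p r i
    by (rule no_l2_kernel[OF near triv ker bound that])
  obtain e t where e: "e \<in> per_E es" "t \<in> {0..a}" "y e t \<noteq> 0" using nz by blast
  obtain p r k where ek: "e = (p, r, k)" by (cases e) auto
  obtain i j m l where es: "es ! k = (i, j, m, l)" by (cases "es ! k") auto
  have "(i, j, m, l) \<in> set es" using e(1) ek es nth_mem[of k es] by (auto simp: per_E_def)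
  then have "i < n" "j < n" using near by (auto simp: near_def)
  then have "y e 0 = 0" "y e a = 0"
    using f[OF e(1)] zero by (simp_all add: per_src_def per_tgt_def ek es)
  moreover from this have "y1 e 0 = 0" using boundary(1)[OF S0 sol[OF e(1)]] S0 by simp
  ultimately have "y e t = 0" using ode_sol_unique_zero(1)[OF Q_L2 sol[OF e(1)] _ _ e(2)] by blast
  then show False using e(3) by blast
qed

end

section \<open>Finitely supported eigenfunctions\<close>

text \<open>A list of weighted edges lets the simplifier check a concrete flow with \<open>v\<close>
  and \<open>\<sigma>\<close> symbolic. Distinct edges and a nonzero first weight prevent
  cancellation to zero.\<close>

definition finite_flow :: "per_graph \<Rightarrow> complex \<Rightarrow> ((int \<times> int \<times> nat) \<times> complex) list \<Rightarrow> bool" where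
  "finite_flow es \<sigma> cs \<longleftrightarrow>
     (\<forall>v. (\<Sum>(e, c)\<leftarrow>cs. c * (of_bool (per_src es e = v) - \<sigma> * of_bool (per_tgt es e = v))) = 0) \<and>
     fst ` set cs \<subseteq> per_E es \<and> cs \<noteq> [] \<and> distinct (map fst cs) \<and> snd (hd cs) \<noteq> 0"

lemma sum_point_masses:
  fixes cs :: "('e \<times> complex) list"
  assumes "finite A"
  shows "(\<Sum>e\<in>A. \<Sum>(e', c)\<leftarrow>cs. if e = e' then c else 0) = (\<Sum>(e', c)\<leftarrow>cs. c * of_bool (e' \<in> A))"
proof (induction cs)
  case (Cons x cs)
  then show ?case using assms by (cases x) (simp add: sum.distrib)
qed simp

lemma (in schrodinger_edge) finite_flow_eigenvalue:
  assumes S0: "S a = 0" and flow: "finite_flow es (S1 a) cs"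
  shows "rho\<^sup>2 \<in> per_point_spectrum a q es"
proof -
  define \<phi> where "\<phi> = (\<lambda>e. \<Sum>(e', c)\<leftarrow>cs. if e = e' then c else 0)"
  have cons: "\<And>v. (\<Sum>(e, c)\<leftarrow>cs. c * (of_bool (per_src es e = v) - S1 a * of_bool (per_tgt es e = v))) = 0"
    and sub: "fst ` set cs \<subseteq> per_E es" and ne: "cs \<noteq> []"
    and dist: "distinct (map fst cs)" and c0: "snd (hd cs) \<noteq> 0"
    using flow unfolding finite_flow_def by auto
  obtain e0 c ds where cs: "cs = (e0, c) # ds" using ne by (cases cs) auto
  have out: "(\<Sum>(e', c)\<leftarrow>ds. if e = e' then c else 0) = 0" if "e \<notin> fst ` set ds" for e ds
    using that by (induction ds) auto
  show ?thesis
  proof (rule flow_eigenvalue[OF S0, of \<phi> e0])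
    have "{e. \<phi> e \<noteq> 0} \<subseteq> fst ` set cs" using out[of _ cs] unfolding \<phi>_def by blast
    then show "finite {e. \<phi> e \<noteq> 0}" by (rule finite_subset) simp
    show "\<phi> e0 \<noteq> 0" using out[of e0 ds] dist c0 by (simp add: \<phi>_def cs)
    show "e0 \<in> per_E es" using sub by (simp add: cs)
    fix v
    have fin: "finite {e \<in> per_E es. per_src es e = v}" "finite {e \<in> per_E es. per_tgt es e = v}"
      using finite_edges_at[of "{v}" es] by (auto elim: finite_subset[rotated])
    have "(\<Sum>e\<in>{e \<in> per_E es. per_src es e = v}. \<phi> e)
        - S1 a * (\<Sum>e\<in>{e \<in> per_E es. per_tgt es e = v}. \<phi> e)
      = (\<Sum>(e, c)\<leftarrow>cs. c * of_bool (e \<in> per_E es \<and> per_src es e = v))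
        - S1 a * (\<Sum>(e, c)\<leftarrow>cs. c * of_bool (e \<in> per_E es \<and> per_tgt es e = v))"
      unfolding \<phi>_def by (simp add: sum_point_masses fin)
    also have "\<dots> = (\<Sum>(e, c)\<leftarrow>cs. c * (of_bool (per_src es e = v) - S1 a * of_bool (per_tgt es e = v)))"
      using sub
    proof (induction cs)
      case (Cons x cs)
      obtain e c where x: "x = (e, c)" by (cases x) auto
      have "e \<in> per_E es" using Cons.prems by (simp add: x)
      moreover note Cons.IH
      ultimately show ?case using Cons.prems by (simp add: x algebra_simps)
    qed simp
    finally show "(\<Sum>e\<in>{e \<in> per_E es. per_src es e = v}. \<phi> e)
        - S1 a * (\<Sum>e\<in>{e \<in> per_E es. per_tgt es e = v}. \<phi> e) = 0" using cons by simp
  qed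
qed

text \<open>Two directed paths of equal length with common ends carry a flow for every \<open>\<sigma>\<close>:
  the weights are \<open>\<sigma>\<^sup>t\<close> along the first and \<open>- \<sigma>\<^sup>t\<close> along the second.\<close>

lemma finite_flows:
  "finite_flow snubSq_graph \<sigma> [((0,0,0), 1), ((0,0,2), \<sigma>), ((0,0,5), - \<sigma>), ((0,0,1), - 1)]"
  "finite_flow rhombi_graph \<sigma> [((0,0,3), 1), ((0,0,5), \<sigma>), ((0,0,4), - \<sigma>), ((0,0,2), - 1)]"
  "finite_flow snubTH_graph \<sigma> [((0,0,0), 1), ((0,0,4), \<sigma>), ((0,0,5), - \<sigma>), ((0,0,1), - 1)]"
  "finite_flow trTH_graph \<sigma> [((0,0,5), 1), ((0,0,7), \<sigma>), ((0,0,8), - \<sigma>), ((0,0,6), - 1)]"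
  "finite_flow trH_graph \<sigma> [((-1,0,6), 1), ((-1,0,8), \<sigma>), ((0,0,1), \<sigma> ^ 2), ((0,0,3), \<sigma> ^ 3),
     ((0,0,4), \<sigma> ^ 4), ((0,0,7), \<sigma> ^ 5), ((-1,0,7), - 1), ((-1,1,2), - \<sigma>), ((-1,1,3), - (\<sigma> ^ 2)),
     ((-1,1,5), - (\<sigma> ^ 3)), ((-1,1,8), - (\<sigma> ^ 4)), ((0,1,0), - (\<sigma> ^ 5))]"
  \<comment> \<open>The closed walks surround a square face, for \<open>snubTH_graph\<close> the
    rhombus of two adjacent triangles, and for \<open>trH_graph\<close> a dodecagon, cut into two
    paths of six edges from (-1,0,4) to (0,1,1).\<close>
  unfolding finite_flow_def per_E_def per_src_def per_tgt_def
    snubSq_graph_def rhombi_graph_def snubTH_graph_def trTH_graph_def trH_graph_def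
  by (simp_all add: algebra_simps eval_nat_numeral)

lemma near_graphs:
  "near 4 snubSq_graph" "near 6 rhombi_graph" "near 6 snubTH_graph" "near 12 trTH_graph" "near 6 trH_graph"
  by (simp_all add: near_def snubSq_graph_def rhombi_graph_def snubTH_graph_def trTH_graph_def trH_graph_def)

lemma out_edges:
  "{..<4} \<subseteq> fst ` set snubSq_graph" "{..<6} \<subseteq> fst ` set rhombi_graph"
  "{..<6} \<subseteq> fst ` set snubTH_graph" "{..<12} \<subseteq> fst ` set trTH_graph" "{..<6} \<subseteq> fst ` set trH_graph"
  by (simp_all add: snubSq_graph_def rhombi_graph_def snubTH_graph_def trTH_graph_def trH_graph_def
      eval_nat_numeral lessThan_Suc)

text \<open>Eigenvectors of the truncated hexagonal tiling supported on one dodecagon, with sign patterns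
  \<open>+ + - -\<close> (adjacency eigenvalue 0) and \<open>+ -\<close> (adjacency eigenvalue -2).\<close>

definition dodecagon_fun :: "(int \<times> int \<times> nat) set \<Rightarrow> (int \<times> int \<times> nat) set \<Rightarrow> int \<times> int \<times> nat \<Rightarrow> complex" where
  "dodecagon_fun A B v = (if v \<in> A then 1 else if v \<in> B then - 1 else 0)"

lemma finite_dodecagon_fun:
  "\<lbrakk>finite A; finite B\<rbrakk> \<Longrightarrow> finite {v. dodecagon_fun A B v \<noteq> 0}"
  by (rule finite_subset[of _ "A \<union> B"]) (auto simp: dodecagon_fun_def)

text \<open>The dodecagon alternates between triangle sides and connecting edges. Signs differ along
  each triangle side, so the third corner of the triangle sees 0; they agree along connecting edges,
  so each vertex of the dodecagon sees 1 - 1 = 0.\<close>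

lemma trH_eigenvector_0:
  "lap trH_graph 0 (dodecagon_fun {(0,0,2), (0,0,3), (0,1,0), (-1,1,5), (-1,1,1), (-1,0,4)}
     {(0,0,4), (0,1,1), (-1,1,3), (-1,1,2), (-1,0,5), (0,0,0)}) v = 0"
proof -
  obtain p r i where v: "v = (p, r, i)" by (cases v) auto
  consider "6 \<le> i" | "i = 0" | "i = 1" | "i = 2" | "i = 3" | "i = 4" | "i = 5" by linarith
  then show ?thesis
    unfolding v by cases (auto simp: lap_def lap_term_def trH_graph_def dodecagon_fun_def)
qed

text \<open>Now signs change along connecting edges as well: the third corners still see 0, and each
  vertex of the dodecagon sees twice its negative, that is 3 \<open>s\<close> times its
  value.\<close>

lemma trH_eigenvector_2:
  "lap trH_graph (- 2 / 3) (dodecagon_fun {(0,0,2), (0,0,4), (0,1,0), (-1,1,3), (-1,1,1), (-1,0,5)}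
     {(0,0,3), (0,1,1), (-1,1,5), (-1,1,2), (-1,0,4), (0,0,0)}) v = 0"
proof -
  obtain p r i where v: "v = (p, r, i)" by (cases v) auto
  consider "6 \<le> i" | "i = 0" | "i = 1" | "i = 2" | "i = 3" | "i = 4" | "i = 5" by linarith
  then show ?thesis
    unfolding v by cases (auto simp: lap_def lap_term_def trH_graph_def dodecagon_fun_def)
qed

theorem theorem7p1:
  fixes a :: real and q :: "real \<Rightarrow> real"
  assumes a_pos: "a > 0"
    and q_meas: "q \<in> borel_measurable (lebesgue_on {0..a})"
    and q_L2: "integrable (lebesgue_on {0..a}) (\<lambda>x. (q x)\<^sup>2)"
    and q_even: "AE x in lebesgue_on {0..a}. q x = q (a - x)"
  shows "per_point_spectrum a q trH_graph =
           {rho\<^sup>2 | rho. S_fun a q a rho = 0 \<or> S_der a q a rho = 0 \<or> S_der a q a rho = - 2 / 3} \<and>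
         per_point_spectrum a q snubSq_graph = {rho\<^sup>2 | rho. S_fun a q a rho = 0} \<and>
         per_point_spectrum a q rhombi_graph = {rho\<^sup>2 | rho. S_fun a q a rho = 0} \<and>
         per_point_spectrum a q snubTH_graph = {rho\<^sup>2 | rho. S_fun a q a rho = 0} \<and>
         per_point_spectrum a q trTH_graph = {rho\<^sup>2 | rho. S_fun a q a rho = 0}"
proof -
  have edge: "schrodinger_edge a q" using assms by unfold_locales
  note S_defs = schrodinger_edge.S_def[OF edge] schrodinger_edge.S1_def[OF edge]
  have flow: "rho\<^sup>2 \<in> per_point_spectrum a q es" if "S_fun a q a rho = 0" "\<And>\<sigma>. finite_flow es \<sigma> (cs \<sigma>)"
    for rho es cs
    using schrodinger_edge.finite_flow_eigenvalue[OF edge _ that(2)] that(1) unfolding S_defs by blast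
  \<comment> \<open>A priori \<open>lam\<close> is any complex number; \<open>csqrt\<close> writes
    it as a square.\<close>
  have nontriv: "\<exists>rho. lam = rho\<^sup>2 \<and> (S_fun a q a rho = 0 \<or> \<not> finite_kernel_trivial n es (S_der a q a rho))"
    if "lam \<in> per_point_spectrum a q es" "near n es" "{..<n} \<subseteq> fst ` set es" for lam n es
    using schrodinger_edge.eigenvalue_not_trivial_kernel[OF edge, of "csqrt lam" es n] that
    unfolding S_defs by (intro exI[of _ "csqrt lam"]) auto
  have trivial: "per_point_spectrum a q es = {rho\<^sup>2 | rho. S_fun a q a rho = 0}"
    if "near n es" "{..<n} \<subseteq> fst ` set es" "\<And>s. finite_kernel_trivial n es s"
      "\<And>\<sigma>. finite_flow es \<sigma> (cs \<sigma>)" for n es cs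
    using nontriv[OF _ that(1,2)] that(3) flow[OF _ that(4)] by blast
  have "per_point_spectrum a q trH_graph =
      {rho\<^sup>2 | rho. S_fun a q a rho = 0 \<or> S_der a q a rho = 0 \<or> S_der a q a rho = - 2 / 3}" (is "_ = ?R")
  proof (intro equalityI subsetI)
    fix lam assume "lam \<in> per_point_spectrum a q trH_graph"
    then show "lam \<in> ?R"
      using nontriv[OF _ near_graphs(5) out_edges(5)] trH_kernel by blast
  next
    \<comment> \<open>This edge starts at a dodecagon vertex with value 1 in both sign patterns,
      which witnesses that the eigenfunctions are nonzero.\<close>
    have src: "per_src trH_graph (0, 0, 3) = (0, 0, 2)" "(0, 0, 3) \<in> per_E trH_graph"
      by (simp_all add: per_src_def per_E_def trH_graph_def)
    fix lam assume "lam \<in> ?R"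
    then obtain rho where rho: "lam = rho\<^sup>2"
      "S_fun a q a rho = 0 \<or> S_der a q a rho = 0 \<or> S_der a q a rho = - 2 / 3" by blast
    show "lam \<in> per_point_spectrum a q trH_graph"
    proof (cases "S_fun a q a rho = 0")
      case True
      then show ?thesis unfolding rho(1) by (rule flow[OF _ finite_flows(5)])
    next
      case False
      note kernel = schrodinger_edge.finite_kernel_eigenvalue[OF edge, unfolded S_defs, OF False
          finite_dodecagon_fun, where es = trH_graph and ?e0.0 = "(0, 0, 3)"]
      from rho(2) False consider "S_der a q a rho = 0" | "S_der a q a rho = - 2 / 3" by blast
      then show ?thesis
      proof cases
        case 1
        show ?thesis unfolding rho(1)
          by (rule kernel[unfolded 1, OF _ _ trH_eigenvector_0]) (simp_all add: src dodecagon_fun_def)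
      next
        case 2
        show ?thesis unfolding rho(1)
          by (rule kernel[unfolded 2, OF _ _ trH_eigenvector_2]) (simp_all add: src dodecagon_fun_def)
      qed
    qed
  qed
  moreover note trivial[OF near_graphs(1) out_edges(1) snubSq_kernel finite_flows(1)]
    trivial[OF near_graphs(2) out_edges(2) rhombi_kernel finite_flows(2)]
    trivial[OF near_graphs(3) out_edges(3) snubTH_kernel finite_flows(3)]
    trivial[OF near_graphs(4) out_edges(4) trTH_kernel finite_flows(4)]
  ultimately show ?thesis by blast
qed

end
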